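(* For every prime $p\ge 5$, the following two congruences hold: $$G_{p-1}\equiv (-1)^{\frac{p-1}{2}}\,256^{p-1}+3p^2E_{p-3}\pmod{p^3},$$ $$\sum_{k=0}^{p-1}\frac{G_k}{16^k}\equiv p^2\left(4(-1)^{\frac{p-1}{2}}-3\right)\pmod{p^3}.$$
   Context: For each integer $n\ge 0$, $$G_n=\sum_{k=0}^n\binom{2k}{k}^2\binom{2n-2k}{n-k}4^{n-k}.$$ The Euler numbers $E_n$ ($n\ge 0$) are the integers defined by $$\frac{2}{e^x+e^{-x}}=\sum_{n=0}^{\infty}E_n\frac{x^n}{n!}.$$ Congruences modulo $p^3$ are understood between rational numbers whose denominators are coprime to $p$: $a\equiv b\pmod{p^3}$ means that $a-b=p^3c$ for some rational number $c$ whose denominator (in lowest terms) is not divisible by $p$. *)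

theory Defs
  imports "HOL-Computational_Algebra.Computational_Algebra"
begin

definition G :: "nat \<Rightarrow> nat" where
  "G n = (\<Sum>k=0..n. ((2 * k) choose k)\<^sup>2 * ((2 * n - 2 * k) choose (n - k)) * 4 ^ (n - k))"

(* The identity 2 / (e^x + e^(-x)) = (\<Sum>n. E_n x^n / n!) read in the ring of formal power series. *)
definition euler_number :: "nat \<Rightarrow> rat" where
  "euler_number n = fact n * fps_nth (2 / (fps_exp 1 + fps_exp (- 1))) n"

(* a \<equiv> b (mod p^r) for rationals; quotient_of yields the fraction in lowest terms. *)
definition rat_cong_prime_power :: "nat \<Rightarrow> nat \<Rightarrow> rat \<Rightarrow> rat \<Rightarrow> bool" where
  "rat_cong_prime_power p r a b \<longleftrightarrow>
     (\<exists>c. a - b = of_nat p ^ r * c \<and> \<not> int p dvd snd (quotient_of c))"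

lemma euler_number_egf:
  "Abs_fps (\<lambda>n. euler_number n / fact n) * (fps_exp 1 + fps_exp (- 1)) = 2"
proof -
  have "Abs_fps (\<lambda>n. euler_number n / fact n) = (2 :: rat fps) / (fps_exp 1 + fps_exp (- 1))"
    by (simp add: fps_eq_iff euler_number_def)
  moreover have "fps_nth (fps_exp 1 + fps_exp (- 1) :: rat fps) 0 \<noteq> 0"
    by simp
  then have "is_unit (fps_exp 1 + fps_exp (- 1) :: rat fps)"
    by (rule fps_is_unit_iff[THEN iffD2])
  ultimately show ?thesis
    by (simp add: dvd_div_mult_self unit_imp_dvd)
qed

lemma euler_number_rec:
  "(\<Sum>k=0..n. of_nat (n choose k) * euler_number k * (1 + (- 1) ^ (n - k))) = (if n = 0 then 2 else 0)"
proof -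
  have "fps_nth (Abs_fps (\<lambda>n. euler_number n / fact n) * (fps_exp 1 + fps_exp (- 1))) n = fps_nth 2 n"
    by (simp add: euler_number_egf)
  then have "(\<Sum>k=0..n. euler_number k / fact k * (1 / fact (n - k) + (- 1) ^ (n - k) / fact (n - k)))
      = (if n = 0 then 2 else 0)"
    by (simp add: fps_mult_nth numeral_fps_const)
  then have "fact n * (\<Sum>k=0..n. euler_number k / fact k * (1 / fact (n - k) + (- 1) ^ (n - k) / fact (n - k)))
      = (if n = 0 then 2 else 0)"
    by simp
  moreover have "fact n * (euler_number k / fact k * (1 / fact (n - k) + (- 1) ^ (n - k) / fact (n - k)))
      = of_nat (n choose k) * euler_number k * (1 + (- 1) ^ (n - k))" if "k \<in> {0..n}" for k
    using that by (simp add: binomial_fact add_divide_distrib[symmetric])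
  ultimately show ?thesis
    by (simp add: sum_distrib_left)
qed

lemma euler_number_Ints: "euler_number n \<in> \<int>"
proof (induction n rule: less_induct)
  case (less n)
  show ?case
  proof (cases "n = 0")
    case True
    then show ?thesis using euler_number_rec[of 0] by simp
  next
    case False
    have half: "(1 + (- 1) ^ m) / 2 \<in> (\<int> :: rat set)" for m :: nat
      by (cases "even m") auto
    have "{0..n} = insert n {0..<n}" by auto
    with euler_number_rec[of n] False
    have "2 * euler_number n =
        - (\<Sum>k=0..<n. of_nat (n choose k) * euler_number k * (1 + (- 1) ^ (n - k)))"
      by simp
    then have "euler_number n =
        - (\<Sum>k=0..<n. of_nat (n choose k) * euler_number k * ((1 + (- 1) ^ (n - k)) / 2))"
      by (simp add: sum_divide_distrib[symmetric])
    moreover have "(\<Sum>k=0..<n. of_nat (n choose k) * euler_number k * ((1 + (- 1) ^ (n - k)) / 2)) \<in> \<int>"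
      by (intro Ints_sum Ints_mult half less.IH Ints_of_nat) auto
    ultimately show ?thesis by (metis Ints_minus)
  qed
qed

end

theory Submission
  imports Defs "HOL-Number_Theory.Residues"
begin

text \<open>
Write \<open>t_k = (2k choose k)^2 / 16^k\<close> and \<open>p = 2m + 1\<close>. The proof starts from the identity
\<open>G n / 16^n = \<Sum>k\<le>n. (-1)^k (n choose k) t_k\<close> (\<open>G_eq_sum_leg\<close>), an instance of a transformation of
terminating hypergeometric sums that needs only Vandermonde's convolution. Everything else rests on
viewing \<open>t_k\<close> as the value at \<open>x = -1/2\<close> of \<open>leg x k = (x choose k) (-1-x choose k)\<close>. This product
is an even function of \<open>x + 1/2\<close>, so moving from \<open>x = -1/2\<close> to the integer \<open>x = m = -1/2 + p/2\<close>
changes it only by a multiple of \<open>p^2\<close>; and at \<open>x = m\<close> the sums can be evaluated exactly.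

\<^emph>\<open>First congruence.\<close> For \<open>n = p - 1\<close> the factor \<open>(-1)^k (p-1 choose k)\<close> is 1 modulo \<open>p\<close>. Hence, modulo
\<open>p^3\<close>, subtracting \<open>S = \<Sum>k<p. t_k\<close> from \<open>G (p-1) / 16^(p-1)\<close> leaves a sum in which \<open>t_k\<close> may be
replaced by \<open>leg m k\<close>. Three evaluations remain.

\<^item> The sum \<open>\<Sum>k. (-1)^k (p-1 choose k) leg m k\<close> is a polynomial in the upper argument \<open>p - 1\<close> that is
  symmetric or antisymmetric under \<open>x \<mapsto> -1 - x\<close> (\<open>reflection\<close>), so it can be computed at \<open>-p\<close>, which
  is close to 0. Expanding in powers of \<open>p\<close> leads to two sums over \<open>leg m k / k\<close>, with and without a
  harmonic number, that have closed forms in \<open>H_m\<close> and \<open>A_m = \<Sum>j\<le>m. (-1)^j / j^2\<close>.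
\<^item> The truncated sum \<open>F(x) = \<Sum>k<p. leg x k\<close> satisfies
  \<open>F(x) + F(x-1) = 2 (x-1 choose p-1) (-x-1 choose p-1)\<close> exactly (\<open>sum_leg_add_shift\<close>). At integers this gives \<open>F(m) = (-1)^m\<close>. Stepping from
  \<open>-p/2\<close>, where \<open>F\<close> is 1 modulo \<open>p^3\<close>, up to \<open>-1/2 = m - p/2\<close> gives \<open>S = (-1)^m (1 - p^2 A_m / 2)\<close>.
\<^item> The two expressions for \<open>(2m choose m)\<close> in \<open>two_power_prod\<close> give
  \<open>16^(p-1) = 1 - 2 p H_m + 2 p^2 H_m^2\<close> modulo \<open>p^3\<close>, which absorbs all harmonic numbers.

What is left is \<open>3/2 (-1)^m p^2 A_m\<close>. By Fermat \<open>A_m\<close> is an alternating sum of \<open>(p-3)\<close>-rd powers modulo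
\<open>p\<close>, which telescopes through the Euler polynomials to \<open>2 (-1)^m E_(p-3)\<close>.

\<^emph>\<open>Second congruence.\<close> Summing the identity for \<open>G\<close> over \<open>n < p\<close> gives \<open>\<Sum>k<p. (-1)^k t_k (p choose k+1)\<close>.
The term \<open>k = p - 1\<close> contributes \<open>p^2\<close>; in the others \<open>p / (k+1)\<close> splits off. The sum of
\<open>t_k / (k+1)\<close> telescopes, and summation by parts reduces that of \<open>H_k t_k / (k+1)\<close> to
\<open>\<Sum>k<p. t_k = (-1)^m\<close> modulo \<open>p\<close>.
\<close>

section \<open>Binomial products and their sums\<close>

text \<open>The coefficient of \<open>y^k\<close> in the Legendre function \<open>P_x(1 - 2y)\<close>. For a natural number \<open>x = m\<close> it
equals \<open>(-1)^k (m choose k) (m+k choose k)\<close>, and for \<open>x = -1/2\<close> it equals \<open>(2k choose k)^2 / 16^k\<close>.\<close>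

definition leg :: "rat \<Rightarrow> nat \<Rightarrow> rat" where
  "leg x k = (x gchoose k) * ((- 1 - x) gchoose k)"

definition harmonic :: "nat \<Rightarrow> rat" where
  "harmonic n = (\<Sum>i=1..n. 1 / of_nat i)"

lemma leg_0 [simp]: "leg x 0 = 1"
  by (simp add: leg_def)

lemma harmonic_0 [simp]: "harmonic 0 = 0"
  by (simp add: harmonic_def)

lemma harmonic_Suc: "harmonic (Suc n) = harmonic n + 1 / of_nat (Suc n)"
  by (simp add: harmonic_def)

lemma sign_sign_mult [simp]: "(- 1) ^ k * ((- 1) ^ k * a) = (a :: rat)"
  by (simp flip: mult.assoc power_mult_distrib)

lemma gbinomial_Suc_right:
  "(x gchoose Suc k) = (x gchoose k) * (x - of_nat k) / of_nat (Suc k)"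
  for x :: "rat"
proof -
  have "of_nat (Suc k) * (x gchoose Suc k) = (x gchoose k) * (x - of_nat k)"
    using gbinomial_mult_1[of x k] by (simp add: algebra_simps)
  then show ?thesis
    by (metis nonzero_mult_div_cancel_left of_nat_neq_0)
qed

text \<open>In terms of \<open>h = x + 1/2\<close> the numerator is \<open>(k + 1/2)^2 - h^2\<close>: this is the evenness in \<open>h\<close> that makes
the passage from \<open>-1/2\<close> to an integer cheap.\<close>

lemma leg_Suc:
  "leg x (Suc k) = leg x k * ((of_nat k - x) * (of_nat k + 1 + x)) / of_nat (Suc k) ^ 2"
  for x :: "rat"
  by (simp add: leg_def gbinomial_Suc_right power2_eq_square)
     (simp add: algebra_simps)

lemma leg_eq_0: "m < k \<Longrightarrow> leg (of_nat m) k = 0"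
  by (simp add: leg_def flip: binomial_gbinomial)

text \<open>The polynomial form of \<open>P_n(-1) = (-1)^n\<close>: at integer \<open>x\<close> with \<open>0 < x \<le> n\<close> the right-hand side vanishes
and the truncated sum alternates in sign, while for other \<open>x\<close> it measures exactly how far this fails. By
Pascal's rule the increment in \<open>n\<close> of the left-hand side reduces to products of neighbouring binomial
coefficients of \<open>x - 1\<close> and \<open>-x - 1\<close>.\<close>

lemma sum_leg_add_shift:
  "(\<Sum>k\<le>n. leg x k) + (\<Sum>k\<le>n. leg (x - 1) k) = 2 * ((x - 1) gchoose n) * ((- x - 1) gchoose n)"
  for x :: "rat"
proof (induction n)
  case (Suc n)
  define a b where "a = (x - 1 gchoose n)" and "b = (- x - 1 gchoose n)"
  define a' b' where "a' = (x - 1 gchoose Suc n)" and "b' = (- x - 1 gchoose Suc n)"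
  have 1: "(x gchoose Suc n) = a' + a" "(- x gchoose Suc n) = b' + b"
    unfolding a_def b_def a'_def b'_def by (rule gbinomial_addition_formula)+
  have 2: "a' = a * (x - 1 - of_nat n) / of_nat (Suc n)" "b' = b * (- x - 1 - of_nat n) / of_nat (Suc n)"
    by (simp_all only: a_def b_def a'_def b'_def gbinomial_Suc_right)
  have eq: "- 1 - x = - x - 1" "- 1 - (x - 1) = - x" by simp_all
  have "leg x (Suc n) = (a' + a) * b'" "leg (x - 1) (Suc n) = a' * (b' + b)"
    unfolding leg_def eq 1 a'_def[symmetric] b'_def[symmetric] by simp_all
  moreover have cross: "a * b' + a' * b = - 2 * (a * b)"
    unfolding 2 using of_nat_neq_0[of n, where 'a=rat] by (simp add: divide_simps del: of_nat_Suc) (simp add: algebra_simps)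
  moreover have "(\<Sum>k\<le>n. leg x k) + (\<Sum>k\<le>n. leg (x - 1) k) = 2 * (a * b)"
    using Suc by (simp add: a_def b_def)
  ultimately have "(\<Sum>k\<le>Suc n. leg x k) + (\<Sum>k\<le>Suc n. leg (x - 1) k)
      = 2 * (a * b) + 2 * (a' * b') + (a * b' + a' * b)"
    by (simp add: distrib_left distrib_right)
  also have "\<dots> = 2 * a' * b'"
    using cross by simp
  finally show ?case by (simp only: a'_def b'_def)
qed auto

lemma sum_leg_nat:
  "m \<le> n \<Longrightarrow> (\<Sum>k\<le>n. leg (of_nat m) k) = (- 1 :: rat) ^ m"
proof (induction m)
  case 0
  have "(\<Sum>k\<le>n. leg (of_nat 0) k) = (\<Sum>k\<in>{0}. leg (0::rat) k)"
    using leg_eq_0[of 0] by (intro sum.mono_neutral_cong_right) auto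
  then show ?case by simp
next
  case (Suc m)
  have *: "of_nat (Suc m) - 1 = (of_nat m :: rat)" by simp
  have "(of_nat m :: rat) gchoose n = 0"
    using Suc.prems by (simp flip: binomial_gbinomial)
  with sum_leg_add_shift[of "of_nat (Suc m) :: rat" n] Suc show ?case
    unfolding * by (simp add: eq_neg_iff_add_eq_0)
qed

section \<open>A transformation of terminating hypergeometric sums\<close>

lemma gbinomial_add_index_expand:
  assumes "k \<le> m"
  shows "(x + of_nat k gchoose k) = (\<Sum>j\<le>m. (x gchoose j) * (of_nat k gchoose j :: rat))"
proof -
  have "(x + of_nat k gchoose k) = (\<Sum>j=0..k. (x gchoose j) * (of_nat k gchoose (k - j)))"
    by (rule gbinomial_Vandermonde[symmetric])
  also have "\<dots> = (\<Sum>j=0..k. (x gchoose j) * (of_nat k gchoose j))"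
    by (intro sum.cong) (auto simp: gbinomial_of_nat_symmetric[symmetric])
  also have "\<dots> = (\<Sum>j\<le>m. (x gchoose j) * (of_nat k gchoose j))"
    using assms by (intro sum.mono_neutral_left) (auto simp flip: binomial_gbinomial)
  finally show ?thesis .
qed

text \<open>Trinomial revision pulls \<open>(m choose j)\<close> out of the sum; Vandermonde's convolution evaluates the rest.\<close>

lemma sum_three_gbinomials:
  assumes j: "j \<le> m"
  shows "(\<Sum>k\<le>m. (of_nat m gchoose k) * (y gchoose k) * (of_nat k gchoose j))
    = (of_nat m gchoose j) * (y + of_nat (m - j) gchoose m :: rat)"
proof -
  have "(of_nat m gchoose k) * (y gchoose k) * (of_nat k gchoose j)
      = (of_nat m gchoose j) * ((y gchoose k) * ((of_nat (m - j) :: rat) gchoose (m - k)))"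
    if k: "k \<le> m" for k
  proof (cases "j \<le> k")
    case True
    have "(of_nat m gchoose k) * (of_nat k gchoose j) = (of_nat m gchoose j) * (of_nat (m - j) gchoose (k - j) :: rat)"
      using gbinomial_trinomial_revision[OF True, of "of_nat m :: rat"] j by simp
    also have "(of_nat (m - j) gchoose (k - j) :: rat) = (of_nat (m - j) gchoose (m - k))"
      using gbinomial_of_nat_symmetric[of "k - j" "m - j", where 'a=rat] True k by simp
    finally show ?thesis by (simp add: mult_ac)
  next
    case False
    then have "(of_nat k gchoose j) = (0::rat)" "(of_nat (m - j) gchoose (m - k)) = (0::rat)"
      using k j by (simp_all flip: binomial_gbinomial del: of_nat_diff)
    then show ?thesis by simp
  qed
  then have "(\<Sum>k\<le>m. (of_nat m gchoose k) * (y gchoose k) * (of_nat k gchoose j))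
      = (\<Sum>k=0..m. (of_nat m gchoose j) * ((y gchoose k) * ((of_nat (m - j) :: rat) gchoose (m - k))))"
    unfolding atMost_atLeast0 by (intro sum.cong) auto
  then show ?thesis
    by (simp only: sum_distrib_left[symmetric] gbinomial_Vandermonde)
qed

text \<open>Expand \<open>(x+k choose k)\<close> by Vandermonde and interchange the sums. Both the reflection formula
(\<open>y = -1 - m\<close>) and the second formula for \<open>G\<close> (\<open>x = y = -1/2\<close>) are special cases.\<close>

lemma hypergeometric_transformation:
  "(\<Sum>k\<le>m. (of_nat m gchoose k) * (y gchoose k) * (x + of_nat k gchoose k))
     = (\<Sum>j\<le>m. (of_nat m gchoose j) * (x gchoose j) * (y + of_nat (m - j) gchoose m :: rat))"
proof -
  have "(\<Sum>k\<le>m. (of_nat m gchoose k) * (y gchoose k) * (x + of_nat k gchoose k))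
      = (\<Sum>k\<le>m. \<Sum>j\<le>m. (x gchoose j) * ((of_nat m gchoose k) * (y gchoose k) * (of_nat k gchoose j)))"
    by (intro sum.cong refl) (auto simp: gbinomial_add_index_expand sum_distrib_left mult_ac)
  also have "\<dots> = (\<Sum>j\<le>m. (x gchoose j) * (\<Sum>k\<le>m. (of_nat m gchoose k) * (y gchoose k) * (of_nat k gchoose j)))"
    unfolding sum_distrib_left by (rule sum.swap)
  also have "\<dots> = (\<Sum>j\<le>m. (of_nat m gchoose j) * (x gchoose j) * (y + of_nat (m - j) gchoose m))"
    by (intro sum.cong refl, subst sum_three_gbinomials) (simp_all del: of_nat_diff)
  finally show ?thesis .
qed

lemma gbinomial_add_index: "(x + of_nat k gchoose k) = (- 1) ^ k * (- 1 - x gchoose k :: rat)"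
  using gbinomial_minus[of "1 + x" k] by (simp add: algebra_simps flip: power_mult_distrib mult.assoc)

text \<open>Since \<open>(x+k choose k) = (-1)^k (-1-x choose k)\<close>, this says that the left-hand side, a polynomial in \<open>x\<close> of
degree \<open>m\<close> (Bateman's polynomial up to an affine change of variable), has parity \<open>(-1)^m\<close> under
\<open>x \<mapsto> -1 - x\<close>.\<close>

lemma reflection:
  "(\<Sum>k\<le>m. (- 1) ^ k * leg (of_nat m) k * (x gchoose k))
     = (- 1) ^ m * (\<Sum>k\<le>m. leg (of_nat m) k * (x + of_nat k gchoose k))"
proof -
  have *: "(- 1 - of_nat m + of_nat (m - j) gchoose m) = (- 1) ^ m * ((- 1) ^ j * (- 1 - of_nat m gchoose j) :: rat)"
    if "j \<le> m" for j
  proof -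
    have "(- 1 - of_nat m + of_nat (m - j) :: rat) = - of_nat j - 1"
      using that by simp
    moreover have "(- 1) ^ m * (- of_nat j - 1 gchoose m) = (- 1) ^ j * (- of_nat m - 1 gchoose j :: rat)"
      by (rule gbinomial_index_swap)
    ultimately show ?thesis by (metis minus_diff_commute sign_sign_mult)
  qed
  have "(- 1) ^ m * (\<Sum>k\<le>m. leg (of_nat m) k * (x + of_nat k gchoose k))
      = (\<Sum>j\<le>m. (- 1) ^ m * ((of_nat m gchoose j) * (x gchoose j) * (- 1 - of_nat m + of_nat (m - j) gchoose m)))"
    unfolding leg_def hypergeometric_transformation sum_distrib_left ..
  also have "\<dots> = (\<Sum>k\<le>m. (- 1) ^ k * leg (of_nat m) k * (x gchoose k))"
  proof (intro sum.cong refl)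
    fix k assume "k \<in> {..m}"
    then show "(- 1) ^ m * ((of_nat m gchoose k) * (x gchoose k) * (- 1 - of_nat m + of_nat (m - k) gchoose m))
        = (- 1) ^ k * leg (of_nat m) k * (x gchoose k)"
      using *[of k] unfolding leg_def atMost_iff
      by (simp only: mult.left_commute[of "(- 1) ^ m" "_ * _"] sign_sign_mult) (simp only: mult_ac)
  qed
  finally show ?thesis ..
qed

section \<open>Legendre sums weighted by harmonic numbers\<close>

text \<open>The mean of \<open>leg x k\<close> and \<open>leg (x - 1) k\<close>. Their difference is \<open>2 k / x\<close> times it, so sums of
\<open>leg m k / k\<close> can be evaluated by induction on \<open>m\<close>; and in contrast to \<open>leg\<close> its partial sums over
\<open>k\<close> have a closed form.\<close>

definition leg_mean :: "rat \<Rightarrow> nat \<Rightarrow> rat" where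
  "leg_mean x k = (x gchoose k) * (- x gchoose k)"

lemma leg_mean_0 [simp]: "leg_mean x 0 = 1"
  by (simp add: leg_mean_def)

text \<open>The absorption rule applied to either factor of \<open>leg\<close>.\<close>

lemma leg_shift:
  shows "x * leg x k = (x + of_nat k) * leg_mean x k"
    and "x * leg (x - 1) k = (x - of_nat k) * leg_mean x k"
proof -
  have "(- x - of_nat k) * (- x gchoose k) = (- x) * (- x - 1 gchoose k)"
    by (rule gbinomial_absorb_comp)
  then have "x * (- 1 - x gchoose k) = (x + of_nat k) * (- x gchoose k)"
    by (simp add: algebra_simps minus_diff_commute)
  then show "x * leg x k = (x + of_nat k) * leg_mean x k"
    unfolding leg_def leg_mean_def by (metis mult.left_commute)
  have "(x - of_nat k) * (x gchoose k) = x * (x - 1 gchoose k)"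
    by (rule gbinomial_absorb_comp)
  moreover have "- 1 - (x - 1) = - x" by simp
  ultimately show "x * leg (x - 1) k = (x - of_nat k) * leg_mean x k"
    unfolding leg_def leg_mean_def by (metis mult.assoc)
qed

lemma leg_nat_diff:
  "leg (of_nat (Suc m)) k - leg (of_nat m) k = 2 * of_nat k / of_nat (Suc m) * leg_mean (of_nat (Suc m)) k"
  and leg_nat_add:
  "leg (of_nat (Suc m)) k + leg (of_nat m) k = 2 * leg_mean (of_nat (Suc m)) k"
proof -
  have M: "of_nat (Suc m) \<noteq> (0::rat)" by (rule of_nat_neq_0)
  note sh = leg_shift[of "of_nat (Suc m)" k]
  have eq: "of_nat (Suc m) - 1 = (of_nat m :: rat)" by simp
  have "of_nat (Suc m) * (leg (of_nat (Suc m)) k - leg (of_nat m) k) = 2 * of_nat k * leg_mean (of_nat (Suc m)) k"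
    using sh unfolding eq right_diff_distrib left_diff_distrib distrib_right by simp
  then show "leg (of_nat (Suc m)) k - leg (of_nat m) k = 2 * of_nat k / of_nat (Suc m) * leg_mean (of_nat (Suc m)) k"
    using M by (simp add: nonzero_eq_divide_eq mult.commute del: of_nat_Suc)
  have "of_nat (Suc m) * (leg (of_nat (Suc m)) k + leg (of_nat m) k) = of_nat (Suc m) * (2 * leg_mean (of_nat (Suc m)) k)"
    using sh unfolding eq distrib_left left_diff_distrib distrib_right by simp
  then show "leg (of_nat (Suc m)) k + leg (of_nat m) k = 2 * leg_mean (of_nat (Suc m)) k"
    using M by (metis mult_left_cancel)
qed

lemma sum_leg_mean: "(\<Sum>k\<le>Suc m. leg_mean (of_nat (Suc m)) k) = 0"
proof -
  have "2 * (\<Sum>k\<le>Suc m. leg_mean (of_nat (Suc m)) k) = (\<Sum>k\<le>Suc m. leg (of_nat (Suc m)) k + leg (of_nat m) k)"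
    unfolding sum_distrib_left by (intro sum.cong refl leg_nat_add[symmetric])
  also have "\<dots> = 0"
    unfolding sum.distrib by (subst (1 2) sum_leg_nat) auto
  finally show ?thesis by simp
qed

lemma sum_index_leg_mean:
  "(\<Sum>k\<le>Suc m. of_nat k * leg_mean (of_nat (Suc m)) k) = of_nat (Suc m) * (- 1) ^ Suc m"
proof -
  have M: "of_nat (Suc m) \<noteq> (0::rat)" by (rule of_nat_neq_0)
  have "2 / of_nat (Suc m) * (\<Sum>k\<le>Suc m. of_nat k * leg_mean (of_nat (Suc m)) k)
      = (\<Sum>k\<le>Suc m. leg (of_nat (Suc m)) k - leg (of_nat m) k)"
    unfolding sum_distrib_left by (intro sum.cong refl) (simp only: leg_nat_diff, simp)
  also have "\<dots> = 2 * (- 1) ^ Suc m"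
    unfolding sum_subtractf by (subst (1 2) sum_leg_nat) auto
  finally show ?thesis using M by (simp add: field_simps del: of_nat_Suc)
qed

lemma sum_leg_over_index:
  "(\<Sum>k=1..m. leg (of_nat m) k / of_nat k) = - 2 * harmonic m"
proof (induction m)
  case (Suc m)
  have "(\<Sum>k=1..m. leg (of_nat m) k / of_nat k) = (\<Sum>k=1..Suc m. leg (of_nat m) k / of_nat k)"
    by (simp add: leg_eq_0)
  then have "(\<Sum>k=1..Suc m. leg (of_nat (Suc m)) k / of_nat k) - (\<Sum>k=1..m. leg (of_nat m) k / of_nat k)
      = (\<Sum>k=1..Suc m. (leg (of_nat (Suc m)) k - leg (of_nat m) k) / of_nat k)"
    by (simp only: sum_subtractf diff_divide_distrib)
  also have "\<dots> = (\<Sum>k=1..Suc m. 2 / of_nat (Suc m) * leg_mean (of_nat (Suc m)) k)"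
    unfolding leg_nat_diff by (intro sum.cong) auto
  also have "\<dots> = 2 / of_nat (Suc m) * ((\<Sum>k\<le>Suc m. leg_mean (of_nat (Suc m)) k) - 1)"
    unfolding sum_distrib_left[symmetric] atMost_atLeast0 by (subst (2) sum.atLeast_Suc_atMost) auto
  also have "\<dots> = - 2 / of_nat (Suc m)"
    unfolding sum_leg_mean by simp
  finally show ?case unfolding Suc harmonic_Suc by simp
qed auto

lemma sum_leg_mean_over_index:
  "(\<Sum>k=1..Suc m. leg_mean (of_nat (Suc m)) k / of_nat k) = 1 / of_nat (Suc m) - 2 * harmonic (Suc m)"
proof -
  have "2 * (\<Sum>k=1..Suc m. leg_mean (of_nat (Suc m)) k / of_nat k)
      = (\<Sum>k=1..Suc m. (leg (of_nat (Suc m)) k + leg (of_nat m) k) / of_nat k)"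
    unfolding sum_distrib_left leg_nat_add by simp
  also have "\<dots> = (\<Sum>k=1..Suc m. leg (of_nat (Suc m)) k / of_nat k) + (\<Sum>k=1..Suc m. leg (of_nat m) k / of_nat k)"
    unfolding add_divide_distrib sum.distrib ..
  also have "(\<Sum>k=1..Suc m. leg (of_nat m) k / of_nat k) = (\<Sum>k=1..m. leg (of_nat m) k / of_nat k)"
    by (simp add: leg_eq_0)
  finally show ?thesis
    unfolding sum_leg_over_index harmonic_Suc by simp
qed

text \<open>Summation by parts, based on the telescoping relation
\<open>x^2 d_k = k^2 d_k - (k+1)^2 d_(k+1)\<close> for \<open>d_k = leg_mean x k\<close>.\<close>

lemma sum_leg_mean_harmonic:
  "x\<^sup>2 * (\<Sum>k\<le>n. leg_mean x k * harmonic k)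
     = (\<Sum>k\<le>n. of_nat k * leg_mean x k) + (x\<^sup>2 - of_nat n ^ 2) * leg_mean x n * harmonic n"
proof (induction n)
  case (Suc n)
  have M: "of_nat (Suc n) \<noteq> (0::rat)" by (rule of_nat_neq_0)
  have dS: "of_nat (Suc n) ^ 2 * leg_mean x (Suc n) = (of_nat n ^ 2 - x\<^sup>2) * leg_mean x n"
    unfolding leg_mean_def gbinomial_Suc_right using M
    by (simp add: power2_eq_square divide_simps del: of_nat_Suc) (simp add: algebra_simps)
  have "(of_nat n ^ 2 - x\<^sup>2) * leg_mean x n * harmonic n = of_nat (Suc n) ^ 2 * leg_mean x (Suc n) * harmonic n"
    by (simp only: dS)
  also have "\<dots> = of_nat (Suc n) ^ 2 * leg_mean x (Suc n) * harmonic (Suc n) - of_nat (Suc n) * leg_mean x (Suc n)"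
    unfolding harmonic_Suc using M by (simp add: divide_simps power2_eq_square del: of_nat_Suc) (simp add: algebra_simps)
  finally show ?case
    unfolding sum.atMost_Suc distrib_left Suc left_diff_distrib mult.assoc by linarith
qed simp

text \<open>Induction on \<open>m\<close>. The increment of the left-hand side is \<open>2/m\<close> times
\<open>\<Sum>k. leg_mean m k (H_k - 1/k)\<close>, and both parts of that sum are known.\<close>

lemma sum_leg_harmonic_over_index:
  "(\<Sum>k=1..m. leg (of_nat m) k * harmonic (k - 1) / of_nat k)
     = 2 * (harmonic m)\<^sup>2 + 2 * (\<Sum>j=1..m. (- 1) ^ j / of_nat j ^ 2)"
proof (induction m)
  case (Suc m)
  define M :: rat where "M = of_nat (Suc m)"
  have M: "M \<noteq> 0" unfolding M_def by (rule of_nat_neq_0)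
  have H: "harmonic k = harmonic (k - 1) + 1 / of_nat k" if "k \<ge> 1" for k
    using that harmonic_Suc[of "k - 1"] by simp
  have dH: "(\<Sum>k=1..Suc m. leg_mean M k * harmonic k) = (- 1) ^ Suc m / M"
  proof -
    have "M\<^sup>2 * (\<Sum>k\<le>Suc m. leg_mean M k * harmonic k) = M * (- 1) ^ Suc m"
      unfolding sum_leg_mean_harmonic by (simp only: M_def sum_index_leg_mean) simp
    moreover have "(\<Sum>k\<le>Suc m. leg_mean M k * harmonic k) = (\<Sum>k=1..Suc m. leg_mean M k * harmonic k)"
      unfolding atMost_atLeast0 by (subst sum.atLeast_Suc_atMost) auto
    ultimately have "M * (M * (\<Sum>k=1..Suc m. leg_mean M k * harmonic k)) = M * (- 1) ^ Suc m"
      by (simp only: power2_eq_square mult.assoc)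
    with M have "M * (\<Sum>k=1..Suc m. leg_mean M k * harmonic k) = (- 1) ^ Suc m"
      by (metis mult_left_cancel)
    with M show ?thesis by (metis nonzero_mult_div_cancel_left)
  qed
  have "(\<Sum>k=1..m. leg (of_nat m) k * harmonic (k - 1) / of_nat k) = (\<Sum>k=1..Suc m. leg (of_nat m) k * harmonic (k - 1) / of_nat k)"
    by (simp add: leg_eq_0)
  then have "(\<Sum>k=1..Suc m. leg M k * harmonic (k - 1) / of_nat k) - (\<Sum>k=1..m. leg (of_nat m) k * harmonic (k - 1) / of_nat k)
      = (\<Sum>k=1..Suc m. (leg M k - leg (of_nat m) k) * harmonic (k - 1) / of_nat k)"
    by (simp only: sum_subtractf diff_divide_distrib left_diff_distrib)
  also have "\<dots> = (\<Sum>k=1..Suc m. 2 / M * (leg_mean M k * harmonic k - leg_mean M k / of_nat k))"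
    unfolding M_def leg_nat_diff by (intro sum.cong refl) (auto simp: H field_simps simp del: of_nat_Suc)
  also have "\<dots> = 2 / M * ((- 1) ^ Suc m / M - (1 / M - 2 * harmonic (Suc m)))"
    unfolding sum_distrib_left[symmetric] sum_subtractf dH unfolding M_def sum_leg_mean_over_index ..
  finally have "(\<Sum>k=1..Suc m. leg M k * harmonic (k - 1) / of_nat k)
      = 2 * (harmonic m)\<^sup>2 + 2 * (\<Sum>j=1..m. (- 1) ^ j / of_nat j ^ 2)
        + 2 / M * ((- 1) ^ Suc m / M - (1 / M - 2 * harmonic (Suc m)))"
    unfolding Suc by simp
  also have "\<dots> = 2 * (harmonic (Suc m))\<^sup>2 + 2 * ((\<Sum>j=1..m. (- 1) ^ j / of_nat j ^ 2) + (- 1) ^ Suc m / M ^ 2)"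
    unfolding harmonic_Suc M_def[symmetric] using M by (simp add: field_simps power2_eq_square)
  finally show ?case by (simp add: M_def)
qed auto

section \<open>Central binomial coefficients and the sequence G\<close>

lemma central_binomial_gbinomial: "of_nat (2 * k choose k) = (- 4) ^ k * (- 1 / 2 gchoose k :: rat)"
proof (induction k)
  case (Suc k)
  have nz: "of_nat (Suc k) \<noteq> (0::rat)" by (rule of_nat_neq_0)
  have "Suc k * (2 * Suc k choose Suc k) = Suc k * (2 * (Suc (2 * k) choose k))"
    using Suc_times_binomial_eq[of "Suc (2 * k)" k] by (simp add: algebra_simps del: binomial_Suc_Suc)
  then have "2 * Suc k choose Suc k = 2 * (Suc (2 * k) choose k)"
    by (metis mult_left_cancel nat.simps(3))
  moreover have "Suc k * (Suc (2 * k) choose k) = Suc (2 * k) * (2 * k choose k)"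
    using binomial_absorb_comp[of "Suc (2 * k)" k] by simp
  ultimately have "Suc k * (2 * Suc k choose Suc k) = 2 * Suc (2 * k) * (2 * k choose k)"
    by (simp add: algebra_simps)
  then have "of_nat (Suc k) * of_nat (2 * Suc k choose Suc k) = 2 * of_nat (Suc (2 * k)) * (of_nat (2 * k choose k) :: rat)"
    by (metis of_nat_mult of_nat_numeral)
  also have "\<dots> = of_nat (Suc k) * ((- 4) ^ Suc k * (- 1 / 2 gchoose Suc k))"
    unfolding Suc gbinomial_Suc_right using nz by (simp add: field_simps del: of_nat_Suc) (simp add: algebra_simps)
  finally show ?case using nz by (metis mult_left_cancel)
qed simp

lemma leg_half: "leg (- 1 / 2) k = (- 1 / 2 gchoose k)\<^sup>2"
  by (simp add: leg_def power2_eq_square)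

lemma leg_half_central_binomial: "16 ^ k * leg (- 1 / 2) k = of_nat (2 * k choose k) ^ 2"
  unfolding leg_half central_binomial_gbinomial power_mult_distrib by (simp add: power2_eq_square flip: power_mult_distrib)

text \<open>Rescaled by \<open>16^n\<close>, the defining sum of \<open>G n\<close> has terms \<open>u_k^2 u_(n-k)\<close> with \<open>u_k = (-1/2 choose k)\<close>
up to sign. Trinomial revision turns them into the right-hand side of the hypergeometric
transformation, whose left-hand side has the terms \<open>(n choose k) u_k (k-1/2 choose k)\<close>.\<close>

lemma G_eq_sum_leg:
  "of_nat (G n) / 16 ^ n = (\<Sum>k\<le>n. (- 1) ^ k * (of_nat n gchoose k) * leg (- 1 / 2) k)"
proof -
  have "of_nat (G n) / 16 ^ n = (\<Sum>k\<le>n. leg (- 1 / 2) k * ((- 1) ^ (n - k) * (- 1 / 2 gchoose (n - k))))"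
  proof -
    have "of_nat (((2 * k) choose k)\<^sup>2 * ((2 * n - 2 * k) choose (n - k)) * 4 ^ (n - k)) / 16 ^ n
        = leg (- 1 / 2) k * ((- 1) ^ (n - k) * (- 1 / 2 gchoose (n - k)))" if "k \<le> n" for k
    proof -
      have "of_nat (((2 * k) choose k)\<^sup>2 * ((2 * n - 2 * k) choose (n - k)) * 4 ^ (n - k))
          = of_nat (2 * k choose k) ^ 2 * of_nat (2 * (n - k) choose (n - k)) * (4::rat) ^ (n - k)"
        by (simp add: diff_mult_distrib2)
      also have "\<dots> = 16 ^ k * leg (- 1 / 2) k * ((- 4) ^ (n - k) * (- 1 / 2 gchoose (n - k))) * 4 ^ (n - k)"
        by (simp only: leg_half_central_binomial central_binomial_gbinomial)
      also have "\<dots> = (16 ^ k * 16 ^ (n - k)) * (leg (- 1 / 2) k * ((- 1) ^ (n - k) * (- 1 / 2 gchoose (n - k))))"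
        by (simp add: mult_ac flip: power_mult_distrib)
      also have "(16::rat) ^ k * 16 ^ (n - k) = 16 ^ n"
        using that by (simp flip: power_add)
      finally show ?thesis by simp
    qed
    then show ?thesis
      unfolding G_def of_nat_sum sum_divide_distrib atMost_atLeast0 by (intro sum.cong) auto
  qed
  also have "\<dots> = (\<Sum>k\<le>n. (of_nat n gchoose k) * (- 1 / 2 gchoose k) * (- 1 / 2 + of_nat (n - k) gchoose n))"
  proof (intro sum.cong refl)
    fix k assume "k \<in> {..n}"
    then have k: "k \<le> n" by simp
    have "(of_nat n gchoose k) * (- 1 / 2 + of_nat (n - k) gchoose n)
        = (- 1 / 2 + of_nat (n - k) gchoose n) * (of_nat n gchoose (n - k) :: rat)"
      using gbinomial_of_nat_symmetric[OF k, where 'a=rat] by simp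
    also have "\<dots> = (- 1 / 2 + of_nat (n - k) gchoose (n - k)) * (- 1 / 2 gchoose (n - (n - k)))"
      by (subst gbinomial_trinomial_revision) (auto simp del: of_nat_diff)
    also have "\<dots> = (- 1) ^ (n - k) * (- 1 / 2 gchoose (n - k)) * (- 1 / 2 gchoose k)"
      unfolding gbinomial_add_index using k by simp
    finally have eq: "(of_nat n gchoose k) * (- 1 / 2 + of_nat (n - k) gchoose n)
        = (- 1) ^ (n - k) * (- 1 / 2 gchoose (n - k)) * (- 1 / 2 gchoose k :: rat)" .
    have "(of_nat n gchoose k) * (- 1 / 2 gchoose k) * (- 1 / 2 + of_nat (n - k) gchoose n)
        = ((of_nat n gchoose k) * (- 1 / 2 + of_nat (n - k) gchoose n)) * (- 1 / 2 gchoose k :: rat)"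
      by (simp only: mult_ac)
    then show "leg (- 1 / 2) k * ((- 1) ^ (n - k) * (- 1 / 2 gchoose (n - k)))
        = (of_nat n gchoose k) * (- 1 / 2 gchoose k) * (- 1 / 2 + of_nat (n - k) gchoose n)"
      unfolding eq leg_half power2_eq_square by (simp only: mult_ac)
  qed
  also have "\<dots> = (\<Sum>k\<le>n. (of_nat n gchoose k) * (- 1 / 2 gchoose k) * (- 1 / 2 + of_nat k gchoose k))"
    by (rule hypergeometric_transformation[symmetric])
  also have "\<dots> = (\<Sum>k\<le>n. (- 1) ^ k * (of_nat n gchoose k) * leg (- 1 / 2) k)"
    unfolding gbinomial_add_index leg_half power2_eq_square by (intro sum.cong refl) simp
  finally show ?thesis .
qed

text \<open>A telescoping sum: \<open>t_k / (k+1)\<close> is the forward difference of \<open>4 k t_k\<close>, where \<open>t_k = leg (-1/2) k\<close>.\<close>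

lemma sum_leg_half_over_Suc:
  "(\<Sum>k<n. leg (- 1 / 2) k / of_nat (Suc k)) = 4 * of_nat n * leg (- 1 / 2) n"
proof (induction n)
  case (Suc n)
  have nz: "of_nat (Suc n) \<noteq> (0::rat)" by (rule of_nat_neq_0)
  show ?case unfolding sum.lessThan_Suc Suc leg_Suc using nz
    by (simp add: divide_simps power2_eq_square del: of_nat_Suc) (simp add: algebra_simps)
qed simp

text \<open>Summation by parts against the previous telescoping sum.\<close>

lemma sum_leg_half_harmonic_over_Suc:
  "(\<Sum>k<n. harmonic k * leg (- 1 / 2) k / of_nat (Suc k))
     = 4 * of_nat n * harmonic n * leg (- 1 / 2) n - 4 * ((\<Sum>k\<le>n. leg (- 1 / 2) k) - 1)"
proof (induction n)
  case (Suc n)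
  have nz: "of_nat (Suc n) \<noteq> (0::rat)" by (rule of_nat_neq_0)
  have "4 * of_nat (Suc n) * leg (- 1 / 2) (Suc n) = 4 * of_nat n * leg (- 1 / 2) n + leg (- 1 / 2) n / of_nat (Suc n)"
    unfolding sum_leg_half_over_Suc[symmetric] by simp
  then have "4 * of_nat (Suc n) * leg (- 1 / 2) (Suc n) * harmonic n
      = 4 * of_nat n * leg (- 1 / 2) n * harmonic n + leg (- 1 / 2) n / of_nat (Suc n) * harmonic n"
    by (simp only: distrib_right)
  moreover have "4 * of_nat (Suc n) * harmonic (Suc n) * leg (- 1 / 2) (Suc n)
     = 4 * of_nat (Suc n) * leg (- 1 / 2) (Suc n) * harmonic n + 4 * leg (- 1 / 2) (Suc n)"
    unfolding harmonic_Suc using nz by (simp add: field_simps del: of_nat_Suc)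
  ultimately show ?case
    unfolding sum.lessThan_Suc sum.atMost_Suc Suc by (simp add: mult_ac)
qed simp

section \<open>Binomial coefficients as products\<close>

lemma gbinomial_prod_add: "(y + of_nat k gchoose k) = (\<Prod>i=1..k. 1 + y / of_nat i :: rat)"
proof (induction k)
  case (Suc k)
  have "of_nat (Suc k) \<noteq> (0::rat)" by (rule of_nat_neq_0)
  then show ?case
    using gbinomial_rec[of "y + of_nat k" k] Suc by (simp add: add.assoc field_simps del: of_nat_Suc) (simp add: algebra_simps)
qed simp

lemma gbinomial_prod_sub: "(y - 1 gchoose k) = (- 1) ^ k * (\<Prod>i=1..k. 1 - y / of_nat i :: rat)"
proof -
  have "(y - 1 gchoose k) = (- 1) ^ k * (- y + of_nat k gchoose k)"
    unfolding gbinomial_add_index by simp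
  then show ?thesis
    unfolding gbinomial_prod_add by simp
qed

text \<open>Both sides are \<open>(-1)^m (2m choose m)\<close>: the right-hand product is \<open>(x-1 choose m)\<close> up to sign with
\<open>x - 1 = 2m\<close>, the left-hand one is \<open>(m-1/2 choose m)\<close> up to sign. For \<open>x = p\<close> this expresses
\<open>2^(p-1)\<close> by products close to 1.\<close>

lemma two_power_prod:
  assumes "x = 2 * of_nat m + (1::rat)"
  shows "4 ^ m * (\<Prod>i=1..m. 1 - (x / 2) / of_nat i) = (\<Prod>i=1..m. 1 - x / of_nat i)"
proof -
  have "(- 1) ^ m * (\<Prod>i=1..m. 1 - (x / 2) / of_nat i) = (- 1 / 2 + of_nat m gchoose m)"
    unfolding gbinomial_prod_sub[symmetric] assms by (simp add: field_simps)
  also have "\<dots> = (- 1) ^ m * (- 1 / 2 gchoose m)"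
    unfolding gbinomial_add_index by simp
  finally have 1: "(\<Prod>i=1..m. 1 - (x / 2) / of_nat i) = (- 1 / 2 gchoose m)"
    by simp
  have "(- 1) ^ m * (\<Prod>i=1..m. 1 - x / of_nat i) = of_nat (2 * m choose m)"
    unfolding gbinomial_prod_sub[symmetric] binomial_gbinomial assms by simp
  also have "\<dots> = (- 1) ^ m * (4 ^ m * (- 1 / 2 gchoose m))"
    unfolding central_binomial_gbinomial by (simp flip: mult.assoc power_mult_distrib)
  finally show ?thesis unfolding 1 by simp
qed

section \<open>Rational numbers integral at a prime\<close>

locale prime_localization =
  fixes p :: nat
  assumes prime_p: "prime p"
begin

abbreviation P :: rat where "P \<equiv> of_nat p"

text \<open>The localization of the integers at the prime ideal \<open>(p)\<close>, as a subring of the rationals.\<close>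

definition Zp :: "rat set" where
  "Zp = {c. \<exists>a b :: int. \<not> int p dvd b \<and> c = of_int a / of_int b}"

definition qcong :: "rat \<Rightarrow> nat \<Rightarrow> rat \<Rightarrow> bool" (\<open>(_ \<approx>\<^bsub>_\<^esub> _)\<close> [51, 0, 51] 50) where
  "a \<approx>\<^bsub>r\<^esub> b \<longleftrightarrow> (\<exists>c\<in>Zp. a - b = P ^ r * c)"

lemma prime_int_p: "prime (int p)"
  using prime_p by simp

lemma p_nonzero [simp]: "P \<noteq> 0"
  using prime_p by (simp add: prime_gt_0_nat)

lemma Zp_divide_int: "\<not> int p dvd b \<Longrightarrow> of_int a / of_int b \<in> Zp"
  by (auto simp: Zp_def)

lemma Zp_of_int: "of_int a \<in> Zp"
proof -
  have "\<not> int p dvd 1" using prime_int_p not_prime_unit by blast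
  from Zp_divide_int[OF this, of a] show ?thesis by simp
qed

lemma Zp_mult: "a \<in> Zp \<Longrightarrow> b \<in> Zp \<Longrightarrow> a * b \<in> Zp"
proof -
  assume "a \<in> Zp" "b \<in> Zp"
  then obtain i j k l where "\<not> int p dvd j" "a = of_int i / of_int j" "\<not> int p dvd l" "b = of_int k / of_int l"
    by (auto simp: Zp_def)
  then show ?thesis
    using Zp_divide_int[of "j * l" "i * k"] prime_int_p by (simp add: prime_dvd_mult_iff)
qed

lemma Zp_add: "a \<in> Zp \<Longrightarrow> b \<in> Zp \<Longrightarrow> a + b \<in> Zp"
proof -
  assume "a \<in> Zp" "b \<in> Zp"
  then obtain i j k l where *: "\<not> int p dvd j" "a = of_int i / of_int j" "\<not> int p dvd l" "b = of_int k / of_int l"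
    by (auto simp: Zp_def)
  then have "j \<noteq> 0" "l \<noteq> 0" by auto
  with * have "a + b = of_int (i * l + k * j) / of_int (j * l)"
    by (simp add: field_simps)
  with * show ?thesis
    using Zp_divide_int[of "j * l" "i * l + k * j"] prime_int_p by (simp add: prime_dvd_mult_iff)
qed

lemma Zp_minus: "a \<in> Zp \<Longrightarrow> - a \<in> Zp"
  using Zp_mult[OF Zp_of_int[of "- 1"], of a] by simp

lemma Zp_diff: "a \<in> Zp \<Longrightarrow> b \<in> Zp \<Longrightarrow> a - b \<in> Zp"
  using Zp_add[OF _ Zp_minus, of a b] by simp

lemma Zp_0: "0 \<in> Zp" and Zp_1: "1 \<in> Zp" and Zp_numeral: "numeral n \<in> Zp" and Zp_of_nat: "of_nat k \<in> Zp"
  using Zp_of_int[of 0] Zp_of_int[of 1] Zp_of_int[of "numeral n"] Zp_of_int[of "int k"] by simp_all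

lemma Zp_power: "a \<in> Zp \<Longrightarrow> a ^ n \<in> Zp"
  by (induction n) (auto intro: Zp_mult Zp_1)

lemma Zp_sum: "(\<And>i. i \<in> I \<Longrightarrow> f i \<in> Zp) \<Longrightarrow> sum f I \<in> Zp"
  by (induction I rule: infinite_finite_induct) (auto intro: Zp_add Zp_0)

lemmas Zp_intros = Zp_of_int Zp_mult Zp_add Zp_minus Zp_diff Zp_0 Zp_1 Zp_numeral Zp_of_nat Zp_power Zp_sum

lemma Zp_quotient_of: "c \<in> Zp \<longleftrightarrow> \<not> int p dvd snd (quotient_of c)"
proof
  assume "c \<in> Zp"
  then obtain a b where ab: "\<not> int p dvd b" "c = of_int a / of_int b" by (auto simp: Zp_def)
  obtain n d where nd: "quotient_of c = (n, d)" by (cases "quotient_of c")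
  have c: "c = of_int n / of_int d" and d: "d > 0" and cop: "coprime n d"
    using nd by (auto simp: quotient_of_div quotient_of_denom_pos quotient_of_coprime)
  have "b \<noteq> 0" using ab by auto
  then have "(of_int (n * b) :: rat) = of_int (a * d)"
    using ab(2) c d by (simp add: field_simps)
  then have "n * b = a * d" by (simp only: of_int_eq_iff)
  then have "d dvd n * b" by simp
  then have "d dvd b" using cop by (simp add: coprime_commute coprime_dvd_mult_right_iff)
  then show "\<not> int p dvd snd (quotient_of c)" using ab(1) nd by (auto dest: dvd_trans)
next
  assume "\<not> int p dvd snd (quotient_of c)"
  then show "c \<in> Zp"
    by (metis Zp_divide_int prod.collapse quotient_of_div)
qed

text \<open>A fraction has a representation with denominator prime to \<open>p\<close> exactly if its lowest terms do; the
existential form is the convenient one for closure properties.\<close>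

lemma rat_cong_iff: "rat_cong_prime_power p r a b \<longleftrightarrow> a \<approx>\<^bsub>r\<^esub> b"
  by (auto simp: rat_cong_prime_power_def qcong_def Zp_quotient_of)

lemma qcongI: "a = b + P ^ r * c \<Longrightarrow> c \<in> Zp \<Longrightarrow> a \<approx>\<^bsub>r\<^esub> b"
  by (auto simp: qcong_def)

lemma qcongE:
  assumes "a \<approx>\<^bsub>r\<^esub> b" obtains c where "c \<in> Zp" "a = b + P ^ r * c"
  using assms by (auto simp: qcong_def algebra_simps)

lemma qcong_refl [simp]: "a \<approx>\<^bsub>r\<^esub> a"
  by (auto intro: qcongI[of _ _ _ 0] Zp_intros)

lemma qcong_sym: "a \<approx>\<^bsub>r\<^esub> b \<Longrightarrow> b \<approx>\<^bsub>r\<^esub> a"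
  by (elim qcongE, rule qcongI[of _ _ _ "- _"]) (auto intro: Zp_intros)

lemma qcong_trans [trans]: "a \<approx>\<^bsub>r\<^esub> b \<Longrightarrow> b \<approx>\<^bsub>r\<^esub> c \<Longrightarrow> a \<approx>\<^bsub>r\<^esub> c"
  by (elim qcongE, rule qcongI[of _ _ _ "_ + _"]) (auto simp: algebra_simps intro: Zp_intros)

lemma qcong_add: "a \<approx>\<^bsub>r\<^esub> b \<Longrightarrow> c \<approx>\<^bsub>r\<^esub> d \<Longrightarrow> a + c \<approx>\<^bsub>r\<^esub> b + d"
  by (elim qcongE, rule qcongI[of _ _ _ "_ + _"]) (auto simp: algebra_simps intro: Zp_intros)

lemma qcong_minus: "a \<approx>\<^bsub>r\<^esub> b \<Longrightarrow> - a \<approx>\<^bsub>r\<^esub> - b"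
  by (elim qcongE, rule qcongI[of _ _ _ "- _"]) (auto intro: Zp_intros)

lemma qcong_diff: "a \<approx>\<^bsub>r\<^esub> b \<Longrightarrow> c \<approx>\<^bsub>r\<^esub> d \<Longrightarrow> a - c \<approx>\<^bsub>r\<^esub> b - d"
  using qcong_add[OF _ qcong_minus, of a r b c d] by simp

lemma qcong_mult_left: "c \<in> Zp \<Longrightarrow> a \<approx>\<^bsub>r\<^esub> b \<Longrightarrow> c * a \<approx>\<^bsub>r\<^esub> c * b"
  by (elim qcongE, rule qcongI[of _ _ _ "c * _"]) (auto simp: algebra_simps intro: Zp_intros)

lemma qcong_Zp: "a \<approx>\<^bsub>r\<^esub> b \<Longrightarrow> b \<in> Zp \<Longrightarrow> a \<in> Zp"
  by (elim qcongE) (auto intro: Zp_intros)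

lemma qcong_mult:
  assumes "a \<approx>\<^bsub>r\<^esub> b" "c \<approx>\<^bsub>r\<^esub> d" "b \<in> Zp" "d \<in> Zp"
  shows "a * c \<approx>\<^bsub>r\<^esub> b * d"
proof -
  have "a * c \<approx>\<^bsub>r\<^esub> a * d" using assms by (intro qcong_mult_left) (auto intro: qcong_Zp)
  also have "a * d \<approx>\<^bsub>r\<^esub> b * d"
    using qcong_mult_left[OF assms(4,1)] by (simp add: mult.commute)
  finally show ?thesis .
qed

lemma qcong_power: "a \<approx>\<^bsub>r\<^esub> b \<Longrightarrow> b \<in> Zp \<Longrightarrow> a ^ n \<approx>\<^bsub>r\<^esub> b ^ n"
  by (induction n) (auto intro: qcong_mult Zp_intros)

lemma qcong_sum: "(\<And>i. i \<in> I \<Longrightarrow> f i \<approx>\<^bsub>r\<^esub> g i) \<Longrightarrow> sum f I \<approx>\<^bsub>r\<^esub> sum g I"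
  by (induction I rule: infinite_finite_induct) (auto intro: qcong_add)

lemma qcong_scale: "a \<approx>\<^bsub>r\<^esub> b \<Longrightarrow> P ^ s * a \<approx>\<^bsub>s + r\<^esub> P ^ s * b"
  by (auto elim!: qcongE intro!: qcongI simp: algebra_simps power_add)

lemma qcong_scale_p:
  "a \<approx>\<^bsub>1\<^esub> b \<Longrightarrow> P * a \<approx>\<^bsub>2\<^esub> P * b"
  "a \<approx>\<^bsub>2\<^esub> b \<Longrightarrow> P * a \<approx>\<^bsub>3\<^esub> P * b"
  "a \<approx>\<^bsub>1\<^esub> b \<Longrightarrow> P\<^sup>2 * a \<approx>\<^bsub>3\<^esub> P\<^sup>2 * b"
  using qcong_scale[of a 1 b 1] qcong_scale[of a 2 b 1] qcong_scale[of a 1 b 2] by (simp_all add: eval_nat_numeral)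

lemma qcong_mono: "a \<approx>\<^bsub>r\<^esub> b \<Longrightarrow> s \<le> r \<Longrightarrow> a \<approx>\<^bsub>s\<^esub> b"
proof (elim qcongE)
  fix c assume c: "c \<in> Zp" "a = b + P ^ r * c" "s \<le> r"
  then have "a = b + P ^ s * (P ^ (r - s) * c)"
    by (simp flip: mult.assoc power_add)
  then show ?thesis by (rule qcongI) (intro Zp_intros c)
qed

text \<open>A number that is congruent to a nonzero residue is a unit of the local ring.\<close>

lemma Zp_inverse_unit:
  assumes "u \<approx>\<^bsub>1\<^esub> of_int n" "\<not> int p dvd n"
  shows "1 / u \<in> Zp" and "u \<noteq> 0"
proof -
  obtain c where c: "c \<in> Zp" "u = of_int n + P * c" using assms(1) by (auto elim!: qcongE)
  then obtain a b where ab: "\<not> int p dvd b" "c = of_int a / of_int b" by (auto simp: Zp_def)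
  have b: "b \<noteq> 0" using ab by auto
  have nd: "\<not> int p dvd n * b + int p * a"
    using ab(1) assms(2) prime_int_p by (simp add: prime_dvd_mult_iff dvd_add_left_iff)
  have u: "u = of_int (n * b + int p * a) / of_int b"
    using b by (simp add: c(2) ab(2) field_simps)
  have "n * b + int p * a \<noteq> 0" using nd by auto
  then show "u \<noteq> 0" using u b by (simp only: divide_eq_0_iff of_int_eq_0_iff) simp
  from u have "1 / u = of_int b / of_int (n * b + int p * a)" by simp
  then show "1 / u \<in> Zp" using Zp_divide_int[OF nd, of b] by (simp only:)
qed

lemma Zp_divide_nat: "a \<in> Zp \<Longrightarrow> 0 < i \<Longrightarrow> i < p \<Longrightarrow> a / of_nat i \<in> Zp"
  using Zp_mult[of a "1 / of_nat i"] Zp_inverse_unit[of "of_nat i" "int i"] nat_dvd_not_less[of i p]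
  by simp

lemma Zp_gbinomial: "x \<in> Zp \<Longrightarrow> k < p \<Longrightarrow> x gchoose k \<in> Zp"
proof (induction k)
  case (Suc k)
  then show ?case unfolding gbinomial_Suc_right
    by (intro Zp_divide_nat Zp_intros) auto
qed (auto intro: Zp_intros)

lemma Zp_leg: "x \<in> Zp \<Longrightarrow> k < p \<Longrightarrow> leg x k \<in> Zp"
  unfolding leg_def by (intro Zp_intros Zp_gbinomial)

lemma Zp_harmonic: "k < p \<Longrightarrow> harmonic k \<in> Zp"
  unfolding harmonic_def by (intro Zp_intros Zp_divide_nat) auto

text \<open>The elementary symmetric polynomials up to degree two; doubling avoids a division.\<close>

lemma prod_expand:
  assumes "finite I" "\<And>i. i \<in> I \<Longrightarrow> z i \<in> Zp"
  shows "2 * (\<Prod>i\<in>I. 1 + P * z i) \<approx>\<^bsub>3\<^esub> 2 + 2 * P * sum z I + P\<^sup>2 * ((sum z I)\<^sup>2 - (\<Sum>i\<in>I. (z i)\<^sup>2))"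
  using assms
proof (induction I)
  case (insert j I)
  define s q where "s = sum z I" and "q = (\<Sum>i\<in>I. (z i)\<^sup>2)"
  have zj: "z j \<in> Zp" using insert.prems by simp
  have sq: "s \<in> Zp" "q \<in> Zp" unfolding s_def q_def using insert.prems by (auto intro!: Zp_intros)
  have "2 * (\<Prod>i\<in>insert j I. 1 + P * z i) = (1 + P * z j) * (2 * (\<Prod>i\<in>I. 1 + P * z i))"
    using insert.hyps by simp
  also have "\<dots> \<approx>\<^bsub>3\<^esub> (1 + P * z j) * (2 + 2 * P * s + P\<^sup>2 * (s\<^sup>2 - q))"
    unfolding s_def q_def using insert zj by (intro qcong_mult_left Zp_intros) auto
  also have "\<dots> = 2 + 2 * P * (z j + s) + P\<^sup>2 * ((z j + s)\<^sup>2 - ((z j)\<^sup>2 + q)) + P ^ 3 * (z j * (s\<^sup>2 - q))"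
    by (simp add: algebra_simps power2_eq_square power3_eq_cube)
  also have "\<dots> \<approx>\<^bsub>3\<^esub> 2 + 2 * P * (z j + s) + P\<^sup>2 * ((z j + s)\<^sup>2 - ((z j)\<^sup>2 + q))"
    by (rule qcongI[OF refl]) (intro Zp_intros zj sq)
  finally show ?case using insert.hyps by (simp add: s_def q_def)
qed auto

lemma prod_expand_first:
  assumes "finite I" "\<And>i. i \<in> I \<Longrightarrow> z i \<in> Zp"
  shows "(\<Prod>i\<in>I. 1 + P * z i) \<approx>\<^bsub>2\<^esub> 1 + P * sum z I"
  using assms
proof (induction I)
  case (insert j I)
  have zj: "z j \<in> Zp" and s: "sum z I \<in> Zp" using insert.prems by (auto intro: Zp_intros)
  have "(\<Prod>i\<in>insert j I. 1 + P * z i) = (1 + P * z j) * (\<Prod>i\<in>I. 1 + P * z i)"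
    using insert.hyps by simp
  also have "\<dots> \<approx>\<^bsub>2\<^esub> (1 + P * z j) * (1 + P * sum z I)"
    using insert zj by (intro qcong_mult_left Zp_intros) auto
  also have "\<dots> = 1 + P * (z j + sum z I) + P ^ 2 * (z j * sum z I)"
    by (simp add: algebra_simps power2_eq_square)
  also have "\<dots> \<approx>\<^bsub>2\<^esub> 1 + P * (z j + sum z I)"
    by (rule qcongI[OF refl]) (intro Zp_intros zj s)
  finally show ?case using insert.hyps by simp
qed auto

lemma fermat_Zp:
  assumes "0 < j" "j < p"
  shows "of_nat j ^ (p - 1) \<approx>\<^bsub>1\<^esub> 1"
proof -
  have "[j ^ (p - 1) = 1] (mod p)"
    using assms by (intro fermat_theorem prime_p) (auto dest: dvd_imp_le)
  then have "[int (j ^ (p - 1)) = int 1] (mod int p)"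
    by (simp only: cong_int_iff)
  then obtain k where "int 1 = int (j ^ (p - 1)) + int p * k"
    unfolding cong_iff_lin by auto
  then have "int (j ^ (p - 1)) = 1 + int p * (- k)" by simp
  then have "(of_int (int (j ^ (p - 1))) :: rat) = of_int (1 + int p * (- k))" by (simp only:)
  then show ?thesis by (intro qcongI[of _ _ _ "of_int (- k)"]) (auto intro: Zp_intros)
qed

end

section \<open>Harmonic sums modulo powers of p\<close>

text \<open>Here \<open>m = (p - 1) / 2\<close> is the residue of \<open>-1/2\<close> modulo \<open>p\<close>. The bound makes 3 invertible, so
that the sums of inverse squares vanish modulo \<open>p\<close>, and the exponent \<open>p - 3\<close> positive.\<close>

locale prime_ge_5 = prime_localization +
  fixes m :: nat
  assumes p_eq: "p = 2 * m + 1" and p_ge_5: "p \<ge> 5"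
begin

lemma P_eq: "P = 2 * of_nat m + 1"
  by (simp add: p_eq)

lemma Zp_two_power: "a \<in> Zp \<Longrightarrow> a / 2 ^ n \<in> Zp"
proof (induction n)
  case (Suc n)
  then have "a / 2 ^ n / of_nat 2 \<in> Zp" using p_ge_5 by (intro Zp_divide_nat) auto
  then show ?case by (simp add: mult.commute)
qed simp

lemma Zp_half: "a \<in> Zp \<Longrightarrow> a / 2 \<in> Zp"
  using Zp_two_power[of a 1] by simp

lemma qcong_halve:
  assumes "2 * a \<approx>\<^bsub>r\<^esub> 2 * b" shows "a \<approx>\<^bsub>r\<^esub> b"
  using qcong_mult_left[OF Zp_half[OF Zp_1] assms] by simp

lemma sum_split_reflect: "(\<Sum>i=1..p - 1. f i) = (\<Sum>i=1..m. f i + f (p - i) :: rat)"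
proof -
  have "{1..p - 1} = {1..m} \<union> {m + 1..p - 1}" using p_eq by auto
  then have "(\<Sum>i=1..p - 1. f i) = (\<Sum>i=1..m. f i) + (\<Sum>i=m + 1..p - 1. f i)"
    by (simp add: sum.union_disjoint)
  also have "(\<Sum>i=m + 1..p - 1. f i) = (\<Sum>i=1..m. f (p - i))"
    by (rule sum.reindex_bij_witness[of _ "\<lambda>i. p - i" "\<lambda>i. p - i"]) (auto simp: p_eq)
  finally show ?thesis by (simp add: sum.distrib)
qed

text \<open>The odd numbers below \<open>p\<close> are the \<open>p - 2i\<close>.\<close>

lemma sum_split_parity: "(\<Sum>i=1..p - 1. f i) = (\<Sum>i=1..m. f (2 * i) + f (p - 2 * i) :: rat)"
proof -
  have "(\<Sum>i=1..m. f (p - 2 * i)) = (\<Sum>i=1..m. f (2 * i - 1))"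
    by (rule sum.reindex_bij_witness[of _ "\<lambda>i. m + 1 - i" "\<lambda>i. m + 1 - i"])
       (auto simp: p_eq intro!: arg_cong[of _ _ f])
  moreover have "(\<Sum>i=1..2 * n. f i) = (\<Sum>i=1..n. f (2 * i) + f (2 * i - 1))" for n
    by (induction n) (auto simp: add_ac)
  ultimately show ?thesis by (simp add: p_eq sum.distrib)
qed

lemma inverse_reflect:
  assumes "0 < i" "i < p"
  shows "1 / of_nat (p - i) \<approx>\<^bsub>1\<^esub> - 1 / of_nat i"
proof (rule qcongI)
  have "of_nat (p - i) = P - of_nat i" "of_nat i \<noteq> (0::rat)" "of_nat (p - i) \<noteq> (0::rat)"
    using assms by (auto simp: of_nat_diff)
  then show "1 / of_nat (p - i) = - 1 / of_nat i + P ^ 1 * (1 / of_nat i / of_nat (p - i))"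
    by (simp add: field_simps)
  show "1 / of_nat i / of_nat (p - i) \<in> Zp"
    using assms by (intro Zp_divide_nat Zp_1) auto
qed

lemma inverse_square_reflect:
  assumes "0 < i" "i < p"
  shows "1 / of_nat (p - i) ^ 2 \<approx>\<^bsub>1\<^esub> 1 / of_nat i ^ 2"
proof -
  have "(1 / of_nat (p - i)) ^ 2 \<approx>\<^bsub>1\<^esub> (- 1 / of_nat i) ^ 2"
    using assms by (intro qcong_power inverse_reflect Zp_divide_nat Zp_intros) auto
  then show ?thesis by (simp add: power_one_over)
qed

lemma Zp_inverse_square: "0 < i \<Longrightarrow> i < p \<Longrightarrow> 1 / of_nat i ^ 2 \<in> Zp"
  using Zp_power[OF Zp_divide_nat[OF Zp_1], of i 2] by (simp add: power_one_over)

text \<open>Let \<open>h\<close> and \<open>s\<close> be the sums up to \<open>m\<close> and up to \<open>p - 1\<close>. Pairing \<open>i\<close> with \<open>p - i\<close> gives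
\<open>s = 2 h\<close>, and pairing \<open>2 i\<close> with \<open>p - 2 i\<close> gives \<open>s = h / 2\<close>. So \<open>3 h = 0\<close> modulo \<open>p\<close>.\<close>

lemma sum_inverse_squares:
  shows sum_inverse_squares_half: "(\<Sum>i=1..m. 1 / of_nat i ^ 2) \<approx>\<^bsub>1\<^esub> 0"
    and sum_inverse_squares_full: "(\<Sum>i=1..p - 1. 1 / of_nat i ^ 2) \<approx>\<^bsub>1\<^esub> 0"
proof -
  define h s :: rat where "h = (\<Sum>i=1..m. 1 / of_nat i ^ 2)" and "s = (\<Sum>i=1..p - 1. 1 / of_nat i ^ 2)"
  have "s \<approx>\<^bsub>1\<^esub> (\<Sum>i=1..m. 1 / of_nat i ^ 2 + 1 / of_nat i ^ 2)"
    unfolding s_def sum_split_reflect using p_eq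
    by (intro qcong_sum qcong_add qcong_refl inverse_square_reflect) auto
  then have s1: "s \<approx>\<^bsub>1\<^esub> 2 * h" by (simp only: h_def sum.distrib mult_2)
  have "s \<approx>\<^bsub>1\<^esub> (\<Sum>i=1..m. 1 / of_nat (2 * i) ^ 2 + 1 / of_nat (2 * i) ^ 2)"
    unfolding s_def sum_split_parity using p_eq
    by (intro qcong_sum qcong_add qcong_refl inverse_square_reflect) auto
  also have "\<dots> = h / 2" by (simp add: h_def sum_divide_distrib power_mult_distrib mult.commute)
  finally have "2 * h \<approx>\<^bsub>1\<^esub> h / 2" using qcong_trans[OF qcong_sym[OF s1]] by blast
  then have "2 * (2 * h) - 2 * (h / 2) \<approx>\<^bsub>1\<^esub> 2 * (h / 2) - 2 * (h / 2)"
    by (intro qcong_diff qcong_refl qcong_mult_left Zp_intros)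
  then have "(1 / of_nat 3) * (3 * h) \<approx>\<^bsub>1\<^esub> (1 / of_nat 3) * 0"
    using p_ge_5 by (intro qcong_mult_left Zp_divide_nat Zp_1) auto
  then show h: "h \<approx>\<^bsub>1\<^esub> 0" by simp
  have "2 * h \<approx>\<^bsub>1\<^esub> 2 * 0" by (intro qcong_mult_left Zp_intros h)
  with s1 show "s \<approx>\<^bsub>1\<^esub> 0" using qcong_trans by fastforce
qed

text \<open>Pairing \<open>i\<close> with \<open>p - i\<close> extracts one factor \<open>p\<close>; the cofactor is minus a sum of inverse squares
modulo \<open>p\<close>, which supplies the second.\<close>

lemma wolstenholme: "harmonic (p - 1) \<approx>\<^bsub>2\<^esub> 0"
proof -
  have m: "m < p" using p_eq by simp
  have "harmonic (p - 1) = (\<Sum>i=1..m. 1 / of_nat i + 1 / of_nat (p - i))"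
    unfolding harmonic_def by (rule sum_split_reflect)
  also have "\<dots> = P * (\<Sum>i=1..m. 1 / of_nat i * (1 / of_nat (p - i)))"
    unfolding sum_distrib_left
  proof (intro sum.cong refl)
    fix i assume i: "i \<in> {1..m}"
    then have "of_nat (p - i) = P - of_nat i" "of_nat i \<noteq> (0::rat)" "of_nat (p - i) \<noteq> (0::rat)"
      using m by (auto simp: of_nat_diff)
    then show "1 / of_nat i + 1 / of_nat (p - i) = P * (1 / of_nat i * (1 / of_nat (p - i)))"
      by (simp add: field_simps)
  qed
  also have "\<dots> \<approx>\<^bsub>2\<^esub> P * (\<Sum>i=1..m. 1 / of_nat i * (- 1 / of_nat i))"
    using m by (intro qcong_scale_p qcong_sum qcong_mult_left inverse_reflect Zp_divide_nat Zp_intros) auto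
  also have "(\<Sum>i=1..m. 1 / of_nat i * (- 1 / of_nat i)) = - (\<Sum>i=1..m. 1 / of_nat i ^ 2 :: rat)"
    by (simp add: sum_negf power2_eq_square)
  also have "P * - (\<Sum>i=1..m. 1 / of_nat i ^ 2) \<approx>\<^bsub>2\<^esub> P * - 0"
    by (intro qcong_scale_p qcong_minus sum_inverse_squares_half)
  finally show ?thesis by simp
qed

text \<open>To this order the product is \<open>exp (- y p H_m)\<close>, because the power sum of degree two vanishes modulo
\<open>p\<close>.\<close>

lemma prod_harmonic:
  assumes y: "y \<in> Zp"
  shows "(\<Prod>i=1..m. 1 - (y * P) / of_nat i) \<approx>\<^bsub>3\<^esub> 1 - y * P * harmonic m + (y * P * harmonic m)\<^sup>2 / 2"
proof -
  define z where "z i = - y * (1 / of_nat i)" for i :: nat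
  define q :: rat where "q = (\<Sum>i=1..m. 1 / of_nat i ^ 2)"
  have m: "m < p" using p_eq by simp
  have "(\<Prod>i=1..m. 1 - (y * P) / of_nat i) = (\<Prod>i=1..m. 1 + P * z i)"
    by (simp add: z_def mult_ac)
  then have "2 * (\<Prod>i=1..m. 1 - (y * P) / of_nat i)
      \<approx>\<^bsub>3\<^esub> 2 + 2 * P * sum z {1..m} + P\<^sup>2 * ((sum z {1..m})\<^sup>2 - (\<Sum>i=1..m. (z i)\<^sup>2))"
    using y m unfolding z_def by (simp only:, intro prod_expand Zp_intros Zp_divide_nat) auto
  also have "sum z {1..m} = - y * harmonic m"
    unfolding z_def harmonic_def sum_distrib_left[symmetric] ..
  also have "(\<Sum>i=1..m. (z i)\<^sup>2) = y\<^sup>2 * q"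
    unfolding z_def q_def sum_distrib_left by (intro sum.cong refl) (simp add: power_mult_distrib power_divide)
  also have "2 + 2 * P * (- y * harmonic m) + P\<^sup>2 * ((- y * harmonic m)\<^sup>2 - y\<^sup>2 * q)
      \<approx>\<^bsub>3\<^esub> 2 + 2 * P * (- y * harmonic m) + P\<^sup>2 * ((- y * harmonic m)\<^sup>2 - y\<^sup>2 * 0)"
  proof -
    have "q \<approx>\<^bsub>1\<^esub> 0" unfolding q_def by (rule sum_inverse_squares_half)
    then have "P\<^sup>2 * ((- y * harmonic m)\<^sup>2 - y\<^sup>2 * q) \<approx>\<^bsub>3\<^esub> P\<^sup>2 * ((- y * harmonic m)\<^sup>2 - y\<^sup>2 * 0)"
      using y by (intro qcong_scale_p qcong_diff qcong_refl qcong_mult_left Zp_intros)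
    then show ?thesis by (intro qcong_add qcong_refl) simp_all
  qed
  finally have "2 * (\<Prod>i=1..m. 1 - (y * P) / of_nat i) \<approx>\<^bsub>3\<^esub> 2 * (1 - y * P * harmonic m + (y * P * harmonic m)\<^sup>2 / 2)"
    by (simp add: algebra_simps power2_eq_square)
  then show ?thesis by (rule qcong_halve)
qed

text \<open>Formally \<open>2^(p-1) = exp (-p H_m) / exp (-p H_m / 2) = exp (-p H_m / 2)\<close>, up to terms of third order in \<open>p\<close>.\<close>

lemma two_power_harmonic: "2 ^ (p - 1) \<approx>\<^bsub>3\<^esub> 1 - P * harmonic m / 2 + (P * harmonic m)\<^sup>2 / 8"
proof -
  define H where "H = harmonic m"
  have H: "H \<in> Zp" unfolding H_def using p_eq by (intro Zp_harmonic) simp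
  define X :: rat where "X = 2 ^ (p - 1)"
  have X: "X \<in> Zp" unfolding X_def by (intro Zp_intros)
  define A where "A = (\<Prod>i=1..m. 1 - (1 / 2 * P) / of_nat i)"
  define B where "B = (\<Prod>i=1..m. 1 - (1 * P) / of_nat i)"
  obtain a where a: "a \<in> Zp" "A = 1 - 1 / 2 * P * H + (1 / 2 * P * H)\<^sup>2 / 2 + P ^ 3 * a"
    using prod_harmonic[OF Zp_half[OF Zp_1]] unfolding A_def H_def by (auto elim!: qcongE)
  obtain b where b: "b \<in> Zp" "B = 1 - 1 * P * H + (1 * P * H)\<^sup>2 / 2 + P ^ 3 * b"
    using prod_harmonic[OF Zp_1] unfolding B_def H_def by (auto elim!: qcongE)
  have "4 ^ m = X" unfolding X_def by (simp add: p_eq power_mult)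
  then have AB: "X * A = B"
    using two_power_prod[OF P_eq] by (simp add: A_def B_def)
  \<comment> \<open>Modulo \<open>p^3\<close> the inverse of \<open>A\<close> is \<open>K\<close>, the truncation of \<open>exp (p H / 2)\<close>; \<open>c\<close> and \<open>d\<close> are the exact remainders.\<close>
  define K where "K = 1 + P * H / 2 + (P * H)\<^sup>2 / 2 ^ 3"
  define c where "c = P * H ^ 4 / 2 ^ 6 + a * K"
  define d where "d = H ^ 3 / 2 ^ 3 + P * H ^ 4 / 2 ^ 4 + b * K"
  have Zp: "K \<in> Zp" "c \<in> Zp" "d \<in> Zp"
    unfolding c_def d_def K_def by (intro Zp_intros Zp_two_power Zp_half H a b)+
  have "A * K = 1 + P ^ 3 * c"
    unfolding a(2) c_def K_def by (simp add: field_simps power2_eq_square eval_nat_numeral)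
  then have "X * (A * K) = X + P ^ 3 * (X * c)"
    by (simp add: algebra_simps)
  moreover have "X * (A * K) = B * K"
    by (simp only: AB[symmetric] mult.assoc)
  moreover have "B * K = 1 - P * H / 2 + (P * H)\<^sup>2 / 8 + P ^ 3 * d"
    unfolding b(2) d_def K_def by (simp add: field_simps power2_eq_square eval_nat_numeral)
  ultimately have "X = 1 - P * H / 2 + (P * H)\<^sup>2 / 8 + P ^ 3 * (d - X * c)"
    unfolding right_diff_distrib by linarith
  then show ?thesis
    unfolding X_def[symmetric] H_def[symmetric]
    by (rule qcongI) (intro Zp_intros X Zp)
qed

lemma sixteen_power_harmonic:
  "16 ^ (p - 1) \<approx>\<^bsub>3\<^esub> 1 - 2 * P * harmonic m + 2 * P\<^sup>2 * (harmonic m)\<^sup>2"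
proof -
  define H where "H = harmonic m"
  have H: "H \<in> Zp" unfolding H_def using p_eq by (intro Zp_harmonic) simp
  have "(16::rat) ^ (p - 1) = (2 ^ (p - 1)) ^ 4"
  proof -
    have "(16::rat) = 2 ^ 4" by simp
    then show ?thesis by (simp only: power_mult[symmetric] mult.commute)
  qed
  also have "\<dots> \<approx>\<^bsub>3\<^esub> (1 - P * H / 2 + (P * H)\<^sup>2 / 2 ^ 3) ^ 4"
    using two_power_harmonic unfolding H_def[symmetric]
    by (intro qcong_power Zp_intros Zp_half Zp_two_power H) simp_all
  also have "\<dots> = 1 - 2 * P * H + 2 * P\<^sup>2 * H\<^sup>2 + P ^ 3 * (- 5 / 2 ^ 2 * H ^ 3 + 17 / 2 ^ 5 * P * H ^ 4 
      - 5 / 2 ^ 5 * P ^ 2 * H ^ 5 + 1 / 2 ^ 5 * P ^ 3 * H ^ 6 - 1 / 2 ^ 8 * P ^ 4 * H ^ 7 + 1 / 2 ^ 12 * P ^ 5 * H ^ 8)"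
    by (simp add: field_simps power2_eq_square eval_nat_numeral)
  also have "\<dots> \<approx>\<^bsub>3\<^esub> 1 - 2 * P * H + 2 * P\<^sup>2 * H\<^sup>2"
    by (rule qcongI[OF refl]) (intro Zp_intros Zp_half Zp_two_power H)
  finally show ?thesis unfolding H_def .
qed

end

section \<open>Euler numbers and alternating sums of inverse squares\<close>

definition alternating_squares :: "nat \<Rightarrow> rat" where
  "alternating_squares m = (\<Sum>j=1..m. (- 1) ^ j / of_nat j ^ 2)"

text \<open>In terms of the classical Euler polynomial this is \<open>2^n E_n((x + 1) / 2)\<close>; the rescaling keeps the
coefficients integral and makes \<open>E_n\<close> the value at 0.\<close>

definition euler_poly :: "nat \<Rightarrow> rat \<Rightarrow> rat" where
  "euler_poly n x = (\<Sum>k=0..n. of_nat (n choose k) * euler_number k * x ^ (n - k))"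

lemma euler_poly_nth:
  "euler_poly n x = fact n * fps_nth (Abs_fps (\<lambda>n. euler_number n / fact n) * fps_exp x) n"
  unfolding euler_poly_def fps_mult_nth sum_distrib_left
  by (intro sum.cong refl) (simp add: binomial_fact)

lemma euler_poly_add: "euler_poly n (x + 1) + euler_poly n (x - 1) = 2 * x ^ n"
proof -
  define E :: "rat fps" where "E = Abs_fps (\<lambda>n. euler_number n / fact n)"
  have "fps_exp (x - 1) = fps_exp x * fps_exp (- 1)"
    using fps_exp_add_mult[of x "- 1"] by simp
  then have "E * fps_exp (x + 1) + E * fps_exp (x - 1) = (E * (fps_exp 1 + fps_exp (- 1))) * fps_exp x"
    by (simp add: fps_exp_add_mult algebra_simps)
  also have "\<dots> = 2 * fps_exp x"
    unfolding E_def euler_number_egf ..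
  finally have "fps_nth (E * fps_exp (x + 1)) n + fps_nth (E * fps_exp (x - 1)) n = 2 * x ^ n / fact n"
    by (simp flip: fps_add_nth) (simp add: numeral_fps_const)
  then show ?thesis
    unfolding euler_poly_nth E_def[symmetric] distrib_left[symmetric] by simp
qed

text \<open>Write \<open>4 (2j)^n\<close> as the sum of the four values of the polynomial at \<open>\<plusminus>2j \<plusminus> 1\<close>; with alternating signs
these telescope. Treating \<open>j\<close> and \<open>-j\<close> together makes the lower boundary term
\<open>euler_poly n 1 + euler_poly n (-1) = 2 * 0^n\<close> vanish.\<close>

lemma alternating_power_sum:
  assumes "even n" "n > 0"
  shows "4 * 2 ^ n * (\<Sum>j=1..M. (- 1) ^ j * of_nat j ^ n)
    = (- 1) ^ M * (euler_poly n (2 * of_nat M + 1) + euler_poly n (- (2 * of_nat M + 1)))"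
proof (induction M)
  case 0
  show ?case using euler_poly_add[of n 0] assms by (simp add: power_0_left)
next
  case (Suc M)
  define x :: rat where "x = 2 * of_nat (Suc M)"
  have x: "x - 1 = 2 * of_nat M + 1" "- x + 1 = - (2 * of_nat M + 1)" "x + 1 = 2 * of_nat (Suc M) + 1"
      "- x - 1 = - (2 * of_nat (Suc M) + 1)"
    by (simp_all add: x_def)
  have "x ^ n = 2 ^ n * of_nat (Suc M) ^ n" "(- x) ^ n = x ^ n"
    using assms(1) by (simp_all only: x_def power_mult_distrib power_minus_even)
  then have "4 * 2 ^ n * of_nat (Suc M) ^ n = (euler_poly n (2 * of_nat (Suc M) + 1) + euler_poly n (- (2 * of_nat (Suc M) + 1)))
      + (euler_poly n (2 * of_nat M + 1) + euler_poly n (- (2 * of_nat M + 1)))"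
    using euler_poly_add[of n x] euler_poly_add[of n "- x"] unfolding x by simp
  then have "4 * 2 ^ n * ((- 1) ^ Suc M * of_nat (Suc M) ^ n) = (- 1) ^ Suc M * ((euler_poly n (2 * of_nat (Suc M) + 1) + euler_poly n (- (2 * of_nat (Suc M) + 1)))
      + (euler_poly n (2 * of_nat M + 1) + euler_poly n (- (2 * of_nat M + 1))))"
    by (simp only: mult.left_commute)
  then show ?case
    using Suc by (simp add: distrib_left right_diff_distrib del: of_nat_Suc)
qed

context prime_ge_5
begin

lemma Zp_euler_number: "euler_number n \<in> Zp"
  using euler_number_Ints[of n] by (auto simp: Ints_def intro: Zp_of_int)

lemma euler_poly_cong:
  assumes "y \<in> Zp" shows "euler_poly n (P * y) \<approx>\<^bsub>1\<^esub> euler_number n"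
proof -
  have "{0..n} = insert n {0..<n}" by auto
  then have "euler_poly n (P * y) = euler_number n + (\<Sum>k=0..<n. of_nat (n choose k) * euler_number k * (P * y) ^ (n - k))"
    unfolding euler_poly_def by simp
  also have "\<dots> \<approx>\<^bsub>1\<^esub> euler_number n + (\<Sum>k=0..<n. 0)"
  proof (intro qcong_add qcong_refl qcong_sum)
    fix k assume "k \<in> {0..<n}"
    then obtain d where d: "n - k = Suc d" by (cases "n - k") auto
    show "of_nat (n choose k) * euler_number k * (P * y) ^ (n - k) \<approx>\<^bsub>1\<^esub> 0"
      unfolding d using assms
      by (intro qcongI[of _ _ _ "of_nat (n choose k) * euler_number k * (y * (P * y) ^ d)"] Zp_intros Zp_euler_number) simp_all
  qed
  finally show ?thesis by simp
qed

text \<open>By Fermat \<open>1/j^2 = j^(p-3)\<close> modulo \<open>p\<close>, so the alternating power sum with \<open>M = m\<close> applies. Its upper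
boundary terms are values at \<open>2m + 1 = p\<close> and at \<open>-p\<close>, both congruent to the constant coefficient.\<close>

lemma alternating_squares_euler:
  "alternating_squares m \<approx>\<^bsub>1\<^esub> 2 * (- 1) ^ m * euler_number (p - 3)"
proof -
  define n where "n = p - 3"
  have n: "even n" "n > 0" "p - 1 = n + 2" using p_eq p_ge_5 by (auto simp: n_def)
  have m: "m < p" using p_eq by simp
  have inv: "of_nat j ^ n \<approx>\<^bsub>1\<^esub> 1 / of_nat j ^ 2" if "0 < j" "j < p" for j
  proof -
    have "(1 / of_nat j ^ 2) * of_nat j ^ (p - 1) \<approx>\<^bsub>1\<^esub> (1 / of_nat j ^ 2) * 1"
      using that by (intro qcong_mult_left fermat_Zp Zp_inverse_square)
    then show ?thesis using that unfolding n by (simp add: power_add power2_eq_square)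
  qed
  \<comment> \<open>The factor \<open>4 * 2^n\<close> of the alternating power sum is \<open>2^(p-1)\<close>.\<close>
  have "4 * 2 ^ n = (of_nat 2 ^ (p - 1) :: rat)" unfolding n by (simp add: power_add)
  then have two: "4 * 2 ^ n \<approx>\<^bsub>1\<^esub> 1" using fermat_Zp[of 2] p_ge_5 by simp
  have Zp: "(\<Sum>j=1..m. (- 1) ^ j * of_nat j ^ n) \<in> Zp" by (intro Zp_intros)
  have "alternating_squares m \<approx>\<^bsub>1\<^esub> (\<Sum>j=1..m. (- 1) ^ j * of_nat j ^ n)"
  proof -
    have "(\<Sum>j=1..m. (- 1) ^ j * (1 / of_nat j ^ 2)) \<approx>\<^bsub>1\<^esub> (\<Sum>j=1..m. (- 1) ^ j * of_nat j ^ n)"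
      using m by (intro qcong_sum qcong_mult_left qcong_sym[OF inv] Zp_intros) auto
    then show ?thesis by (simp add: alternating_squares_def)
  qed
  also have "\<dots> \<approx>\<^bsub>1\<^esub> (\<Sum>j=1..m. (- 1) ^ j * of_nat j ^ n) * (4 * 2 ^ n)"
    using qcong_mult_left[OF Zp qcong_sym[OF two]] by simp
  also have "\<dots> = (- 1) ^ m * (euler_poly n (P * 1) + euler_poly n (P * (- 1)))"
    using alternating_power_sum[OF n(1,2), of m] by (simp add: P_eq mult.commute)
  also have "\<dots> \<approx>\<^bsub>1\<^esub> (- 1) ^ m * (euler_number n + euler_number n)"
    by (intro qcong_mult_left qcong_add euler_poly_cong Zp_intros)
  also have "\<dots> = 2 * (- 1) ^ m * euler_number (p - 3)"
    by (simp add: n_def)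
  finally show ?thesis .
qed

section \<open>Truncated Legendre sums modulo the cube of p\<close>

text \<open>For \<open>k > 0\<close> one has \<open>leg x k = - (x/k) (1 + x/k) (1 - x^2/1^2) ... (1 - x^2/(k-1)^2)\<close>, and the
factors with squares change it only to third order in \<open>x\<close>.\<close>

lemma leg_multiple_p:
  assumes y: "y \<in> Zp"
  shows "Suc k < p \<Longrightarrow> leg (P * y) (Suc k) \<approx>\<^bsub>3\<^esub> - (P * y) / of_nat (Suc k) - P\<^sup>2 * y\<^sup>2 / of_nat (Suc k) ^ 2"
proof (induction k)
  case 0
  show ?case by (simp add: leg_def algebra_simps power2_eq_square)
next
  case (Suc k)
  define i :: rat where "i = of_nat (Suc k)"
  have i: "i \<noteq> 0" "i + 1 \<noteq> 0" "of_nat (Suc (Suc k)) = i + 1"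
    unfolding i_def using of_nat_neq_0[of "Suc k", where 'a=rat] by (auto simp del: of_nat_Suc simp: add.commute of_nat_Suc[of "Suc k"])
  have Zi: "1 / i \<in> Zp" "1 / (i + 1) \<in> Zp" "i \<in> Zp"
    using Zp_divide_nat[OF Zp_1, of "Suc k"] Zp_divide_nat[OF Zp_1, of "Suc (Suc k)"] Suc.prems
    unfolding i(3) i_def[symmetric] by (auto simp: i_def Zp_of_nat simp del: of_nat_Suc)
  obtain w where w: "w \<in> Zp" "leg (P * y) (Suc k) = - (P * y) / i - P\<^sup>2 * y\<^sup>2 / i ^ 2 + P ^ 3 * w"
    using Suc unfolding i_def by (auto elim!: qcongE simp del: of_nat_Suc)
  define c where "c = (1 / i) ^ 2 * (1 / (i + 1)) ^ 2 * y ^ 3 * (i + 1 + P * y)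
      + w * ((i - P * y) * (i + 1 + P * y) * (1 / (i + 1)) ^ 2)"
  have "leg (P * y) (Suc (Suc k)) = - (P * y) / (i + 1) - P\<^sup>2 * y\<^sup>2 / (i + 1) ^ 2 + P ^ 3 * c"
    unfolding leg_Suc[of _ "Suc k"] w(2) i(3) i_def[symmetric] c_def using i(1,2)
    by (simp add: divide_simps) (simp add: algebra_simps eval_nat_numeral)
  then show ?case unfolding i(3) c_def
    by (rule qcongI) (intro Zp_intros Zi w y)
qed

lemma sum_leg_multiple_p:
  assumes y: "y \<in> Zp"
  shows "(\<Sum>k\<le>p - 1. leg (P * y) k) \<approx>\<^bsub>3\<^esub> 1"
proof -
  have "(\<Sum>k\<le>p - 1. leg (P * y) k) = 1 + (\<Sum>k=1..p - 1. leg (P * y) k)"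
    unfolding atMost_atLeast0 by (subst sum.atLeast_Suc_atMost) auto
  also have "\<dots> \<approx>\<^bsub>3\<^esub> 1 + (\<Sum>k=1..p - 1. - (P * y) / of_nat k - P\<^sup>2 * y\<^sup>2 / of_nat k ^ 2)"
  proof (intro qcong_add qcong_refl qcong_sum)
    fix k assume "k \<in> {1..p - 1}"
    then have "Suc (k - 1) = k" "k < p" using p_ge_5 by auto
    then show "leg (P * y) k \<approx>\<^bsub>3\<^esub> - (P * y) / of_nat k - P\<^sup>2 * y\<^sup>2 / of_nat k ^ 2"
      using leg_multiple_p[OF y, of "k - 1"] by (simp only:)
  qed
  also have "\<dots> = 1 - (y * (P * harmonic (p - 1)) + y\<^sup>2 * (P\<^sup>2 * (\<Sum>k=1..p - 1. 1 / of_nat k ^ 2)))"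
    by (simp add: harmonic_def sum_subtractf sum_negf sum_distrib_left mult_ac)
  also have "\<dots> \<approx>\<^bsub>3\<^esub> 1 - (y * (P * 0) + y\<^sup>2 * (P\<^sup>2 * 0))"
  proof -
    have "P * harmonic (p - 1) \<approx>\<^bsub>3\<^esub> P * 0"
        "P\<^sup>2 * (\<Sum>k=1..p - 1. 1 / of_nat k ^ 2) \<approx>\<^bsub>3\<^esub> P\<^sup>2 * 0"
      by (intro qcong_scale_p wolstenholme sum_inverse_squares_full)+
    then show ?thesis
      by (intro qcong_diff qcong_add qcong_refl qcong_mult_left[OF y] qcong_mult_left[OF Zp_power[OF y]])
  qed
  finally show ?thesis by simp
qed

text \<open>Among the \<open>p - 1\<close> consecutive factors of the numerator exactly one, \<open>p y\<close>, is divisible by \<open>p\<close>, and the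
others run over all nonzero residues but \<open>j\<close>. The proof is by induction on \<open>j\<close>, moving the window of factors by one.\<close>

lemma gbinomial_p_minus_1:
  assumes y: "y \<in> Zp" and j: "1 \<le> j" "j < p"
  shows "(of_nat j - 1 + P * y gchoose (p - 1)) \<approx>\<^bsub>2\<^esub> P * y / of_nat j"
  using j
proof (induction j rule: dec_induct)
  case base
  define q where "q = p - 2"
  have q: "p - 1 = Suc q" "odd q" "P = of_nat q + 2" "q < p" "0 < Suc q" "Suc q < p"
    using p_eq p_ge_5 by (auto simp: q_def)
  have "(P * y gchoose (p - 1)) = P * (y * (1 / of_nat (Suc q)) * (P * y - 1 gchoose q))"
    using gbinomial_absorption'[of "Suc q" "P * y"] unfolding q by (simp add: mult_ac)
  also have "\<dots> \<approx>\<^bsub>2\<^esub> P * (y * - 1 * - 1)"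
  proof (intro qcong_scale_p qcong_mult qcong_refl y Zp_intros)
    have "P = of_nat (Suc q) + 1" using q by simp
    then have "1 / of_nat (Suc q) = - 1 + P ^ 1 * (1 / of_nat (Suc q))"
      using of_nat_neq_0[of q, where 'a=rat] by (simp add: divide_simps del: of_nat_Suc)
    then show "1 / of_nat (Suc q) \<approx>\<^bsub>1\<^esub> - 1"
      using q by (intro qcongI[of _ _ _ "1 / of_nat (Suc q)"] Zp_divide_nat Zp_1)
    have "(\<Prod>i=1..q. 1 + P * (- y * (1 / of_nat i))) \<approx>\<^bsub>2\<^esub> 1 + P * (\<Sum>i=1..q. - y * (1 / of_nat i))"
      using q by (intro prod_expand_first Zp_intros Zp_divide_nat y) auto
    then have "(\<Prod>i=1..q. 1 + P * (- y * (1 / of_nat i))) \<approx>\<^bsub>1\<^esub> 1 + P * (\<Sum>i=1..q. - y * (1 / of_nat i))"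
      by (rule qcong_mono) simp
    also have "\<dots> \<approx>\<^bsub>1\<^esub> 1"
      using q by (intro qcongI[of _ _ _ "\<Sum>i=1..q. - y * (1 / of_nat i)"] Zp_intros Zp_divide_nat y) auto
    finally have "- 1 * (\<Prod>i=1..q. 1 + P * (- y * (1 / of_nat i))) \<approx>\<^bsub>1\<^esub> - 1 * 1"
      by (intro qcong_mult_left Zp_intros)
    then show "(P * y - 1 gchoose q) \<approx>\<^bsub>1\<^esub> - 1"
      unfolding gbinomial_prod_sub using q(2) by simp
  qed
  finally show ?case by simp
next
  case (step j)
  define a where "a = of_nat j + P * y"
  \<comment> \<open>Moving the window replaces its lowest factor \<open>u\<close>, congruent to \<open>j + 1\<close>, by the new top factor \<open>a\<close>.\<close>
  define u where "u = of_nat (Suc j) + P * (y - 1)"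
  have j: "1 \<le> j" "j < p" "Suc j < p" using step by auto
  have "u \<approx>\<^bsub>1\<^esub> of_int (int (Suc j))"
    by (intro qcongI[of _ _ _ "y - 1"] Zp_intros y) (simp add: u_def)
  moreover have "\<not> int p dvd int (Suc j)"
    using j by (auto simp only: int_dvd_int_iff dest!: dvd_imp_le)
  ultimately have iu: "1 / u \<in> Zp" and u0: "u \<noteq> 0"
    by (rule Zp_inverse_unit)+
  have "(a - of_nat (p - 1)) * (a gchoose (p - 1)) = a * (a - 1 gchoose (p - 1))"
    by (rule gbinomial_absorb_comp)
  moreover have "a - of_nat (p - 1) = u" using p_ge_5 by (simp add: a_def u_def of_nat_diff algebra_simps)
  ultimately have "(a gchoose (p - 1)) = a * (a - 1 gchoose (p - 1)) / u"
    using u0 by (simp add: field_simps)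
  moreover have "a - 1 = of_nat j - 1 + P * y" by (simp add: a_def)
  moreover obtain w where w: "w \<in> Zp" "(of_nat j - 1 + P * y gchoose (p - 1)) = P * y / of_nat j + P\<^sup>2 * w"
    using step j by (auto elim!: qcongE)
  ultimately have *: "(a gchoose (p - 1)) = a * (P * y / of_nat j + P\<^sup>2 * w) / u" by simp
  have j0: "of_nat j \<noteq> (0::rat)" "of_nat (Suc j) \<noteq> (0::rat)" using j by auto
  define c where "c = y * (y + of_nat j) * (1 / u) * (1 / of_nat j) * (1 / of_nat (Suc j)) + w * a * (1 / u)"
  have "(a gchoose (p - 1)) = P * y / of_nat (Suc j) + P\<^sup>2 * c"
    unfolding * c_def using j0 u0
    by (simp add: divide_simps del: of_nat_Suc) (simp add: a_def u_def algebra_simps power2_eq_square)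
  moreover have "c \<in> Zp" unfolding c_def a_def
    by (intro Zp_intros iu w y Zp_divide_nat) (use j in auto)
  ultimately show ?case by (intro qcongI[of _ _ _ c]) (simp_all add: a_def)
qed

lemma m_less: "m < p" "m \<le> p - 1" "even (p - 1)"
  using p_eq by auto

lemma Zp_alternating_squares: "alternating_squares m \<in> Zp"
  using alternating_squares_euler by (rule qcong_Zp) (intro Zp_intros Zp_euler_number)

text \<open>The argument moves from \<open>-p/2\<close> to \<open>m - p/2 = -1/2\<close> in unit steps. At \<open>x = j - p/2\<close> each of the two
binomial coefficients in \<open>sum_leg_add_shift\<close> contributes one factor \<open>p\<close>, so only their leading terms count:
their product is \<open>(-p/(2j)) (p/(2j))\<close>.\<close>

lemma sum_leg_half_cong:
  "(\<Sum>k\<le>p - 1. leg (- 1 / 2) k) \<approx>\<^bsub>3\<^esub> (- 1) ^ m * (1 - P\<^sup>2 * alternating_squares m / 2)"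
proof -
  define y :: rat where "y = - 1 / 2"
  have y: "y \<in> Zp" unfolding y_def by (intro Zp_half Zp_intros)
  define f where "f n = (\<Sum>k\<le>p - 1. leg (of_nat n + P * y) k)" for n
  have "f n \<approx>\<^bsub>3\<^esub> (- 1) ^ n * (1 - P\<^sup>2 * (alternating_squares n / 2))" if "n \<le> m" for n
    using that
  proof (induction n)
    case 0
    show ?case using sum_leg_multiple_p[OF y] by (simp add: f_def alternating_squares_def)
  next
    case (Suc n)
    define j where "j = Suc n"
    have j: "1 \<le> j" "j < p" "1 \<le> p - j" "p - j < p" using Suc.prems p_eq by (auto simp: j_def)
    define x where "x = of_nat j + P * y"
    obtain a where a: "a \<in> Zp" "(of_nat j - 1 + P * y gchoose (p - 1)) = P * y / of_nat j + P ^ 2 * a"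
      using gbinomial_p_minus_1[OF y j(1,2)] by (auto elim!: qcongE)
    obtain b where b: "b \<in> Zp" "(of_nat (p - j) - 1 + P * y gchoose (p - 1)) = P * y / of_nat (p - j) + P ^ 2 * b"
      using gbinomial_p_minus_1[OF y j(3,4)] by (auto elim!: qcongE)
    \<comment> \<open>With \<open>y = -1/2\<close> also \<open>-x\<close> has the form of \<open>x\<close>, with \<open>p - j\<close> in place of \<open>j\<close>.\<close>
    have "of_nat (p - j) + P * y = - x"
      using j by (simp add: x_def y_def of_nat_diff field_simps)
    then have eqs: "x - 1 = of_nat j - 1 + P * y" "- x - 1 = of_nat (p - j) - 1 + P * y"
      by (simp_all add: x_def algebra_simps)
    have "f j + f n = 2 * (x - 1 gchoose (p - 1)) * (- x - 1 gchoose (p - 1))"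
      using sum_leg_add_shift[of x "p - 1"] by (simp add: f_def x_def j_def)
    also have "\<dots> = P ^ 2 * (2 * (y * (1 / of_nat j) * (y * (1 / of_nat (p - j)))))
        + P ^ 3 * (2 * (y * (1 / of_nat j) * b + a * (y * (1 / of_nat (p - j))) + P * a * b))"
      unfolding eqs a(2) b(2) by (simp add: algebra_simps eval_nat_numeral)
    also have "\<dots> \<approx>\<^bsub>3\<^esub> P ^ 2 * (2 * (y * (1 / of_nat j) * (y * (1 / of_nat (p - j)))))"
      using j by (intro qcongI[OF refl] Zp_intros y a b Zp_divide_nat) auto
    also have "\<dots> \<approx>\<^bsub>3\<^esub> P ^ 2 * (2 * (y * (1 / of_nat j) * (y * (- 1 / of_nat j))))"
      using j by (intro qcong_scale_p qcong_mult_left inverse_reflect Zp_intros Zp_divide_nat y) auto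
    also have "\<dots> = - (P ^ 2 * ((1 / of_nat j ^ 2) / 2))"
      by (simp add: y_def power2_eq_square)
    finally have fj: "f j + f n \<approx>\<^bsub>3\<^esub> - (P ^ 2 * ((1 / of_nat j ^ 2) / 2))" .
    have "f n \<approx>\<^bsub>3\<^esub> (- 1) ^ n * (1 - P\<^sup>2 * (alternating_squares n / 2))"
      using Suc by simp
    from qcong_diff[OF fj this]
    have "f j \<approx>\<^bsub>3\<^esub> - (P ^ 2 * ((1 / of_nat j ^ 2) / 2)) - (- 1) ^ n * (1 - P\<^sup>2 * (alternating_squares n / 2))"
      by simp
    also have "\<dots> = (- 1) ^ j * (1 - P\<^sup>2 * (alternating_squares j / 2))"
    proof -
      have "alternating_squares j = alternating_squares n + (- 1) ^ j / of_nat j ^ 2"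
        by (simp add: alternating_squares_def j_def)
      then have "(- 1) ^ j * (1 - P\<^sup>2 * (alternating_squares j / 2))
          = (- 1) ^ j * (1 - P\<^sup>2 * (alternating_squares n / 2)) - (- 1) ^ j * ((- 1) ^ j * (P\<^sup>2 * ((1 / of_nat j ^ 2) / 2)))"
        by (simp add: algebra_simps add_divide_distrib)
      then show ?thesis unfolding sign_sign_mult by (simp add: j_def)
    qed
    finally show ?case unfolding j_def .
  qed
  moreover have "of_nat m + P * y = - 1 / 2"
    unfolding y_def P_eq by (simp add: field_simps)
  ultimately show ?thesis unfolding f_def by fastforce
qed

text \<open>The integer \<open>m\<close> is \<open>-1/2 + p/2\<close>, and \<open>leg\<close> is even about \<open>-1/2\<close>, so there is no term of first order.\<close>

lemma leg_half_cong: "k < p \<Longrightarrow> leg (- 1 / 2) k \<approx>\<^bsub>2\<^esub> leg (of_nat m) k"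
proof (induction k)
  case (Suc k)
  have inv: "1 / of_nat (Suc k) ^ 2 \<in> Zp" using Suc.prems by (intro Zp_inverse_square) auto
  define h where "h = of_nat k + (1 / 2 :: rat)"
  have h: "h \<in> Zp" unfolding h_def by (intro Zp_intros Zp_half)
  have "leg (- 1 / 2) (Suc k) = leg (- 1 / 2) k * (h\<^sup>2 * (1 / of_nat (Suc k) ^ 2))"
    by (simp add: leg_Suc h_def power2_eq_square algebra_simps)
  also have "\<dots> \<approx>\<^bsub>2\<^esub> leg (of_nat m) k * ((h\<^sup>2 + P\<^sup>2 * (- 1 / 2 ^ 2)) * (1 / of_nat (Suc k) ^ 2))"
  proof (intro qcong_mult)
    show "leg (- 1 / 2) k \<approx>\<^bsub>2\<^esub> leg (of_nat m) k" using Suc by simp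
    show "h\<^sup>2 \<approx>\<^bsub>2\<^esub> h\<^sup>2 + P\<^sup>2 * (- 1 / 2 ^ 2)"
      by (rule qcongI[of _ _ _ "1 / 2 ^ 2"]) (simp, intro Zp_two_power Zp_1)
    show "leg (of_nat m) k \<in> Zp" using Suc.prems by (intro Zp_leg Zp_intros) simp
  qed (intro Zp_intros h inv Zp_two_power qcong_refl)+
  also have "\<dots> = leg (of_nat m) (Suc k)"
  proof -
    have "(of_nat m :: rat) = (P - 1) / 2" unfolding P_eq by simp
    then have "(of_nat k - of_nat m) * (of_nat k + 1 + of_nat m) = h\<^sup>2 + P\<^sup>2 * (- 1 / 2 ^ 2)"
      by (simp only: h_def) (simp add: field_simps power2_eq_square)
    then show ?thesis unfolding leg_Suc by simp
  qed
  finally show ?case .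
qed simp

lemma signed_binomial_expand:
  assumes "k < p"
  shows "(- 1) ^ k * (P - 1 gchoose k) \<approx>\<^bsub>2\<^esub> 1 - P * harmonic k"
proof -
  have "(- 1) ^ k * (P - 1 gchoose k) = (\<Prod>i=1..k. 1 + P * (- (1 / of_nat i)))"
    unfolding gbinomial_prod_sub by simp
  also have "\<dots> \<approx>\<^bsub>2\<^esub> 1 + P * (\<Sum>i=1..k. - (1 / of_nat i))"
    using assms by (intro prod_expand_first Zp_intros Zp_divide_nat) auto
  finally show ?thesis by (simp add: harmonic_def sum_negf)
qed

lemma gbinomial_shift_expand:
  assumes "1 \<le> k" "k < p"
  shows "(P - 1 + of_nat k gchoose k) \<approx>\<^bsub>3\<^esub> P * (1 / of_nat k + P * (harmonic (k - 1) / of_nat k))"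
proof -
  obtain l where l: "k = Suc l" using assms by (cases k) auto
  have "(P - 1 + of_nat k gchoose k) = P * ((1 / of_nat k) * (P + of_nat l gchoose l))"
    using gbinomial_factors[of "P + of_nat l - 1" l] gbinomial_absorb_comp[of "P + of_nat l" l] unfolding l
    by (simp add: algebra_simps)
  also have "(P + of_nat l gchoose l) = (\<Prod>i=1..l. 1 + P * (1 / of_nat i))"
    by (simp add: gbinomial_prod_add)
  also have "P * ((1 / of_nat k) * \<dots>) \<approx>\<^bsub>3\<^esub> P * ((1 / of_nat k) * (1 + P * (\<Sum>i=1..l. 1 / of_nat i)))"
    using assms unfolding l by (intro qcong_scale_p qcong_mult_left prod_expand_first Zp_intros Zp_divide_nat) auto
  finally show ?thesis by (simp add: harmonic_def l distrib_left)
qed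

text \<open>Reflection replaces \<open>(-1)^k (p-1 choose k)\<close> by \<open>(p-1+k choose k)\<close>, which for \<open>k > 0\<close> is divisible by \<open>p\<close>
because \<open>k < p\<close>. Only an expansion of the cofactor modulo \<open>p^2\<close> is then required.\<close>

lemma sum_leg_signed_binomial:
  "(\<Sum>k\<le>p - 1. (- 1) ^ k * (P - 1 gchoose k) * leg (of_nat m) k)
    \<approx>\<^bsub>3\<^esub> (- 1) ^ m * (1 - 2 * P * harmonic m + 2 * P\<^sup>2 * ((harmonic m)\<^sup>2 + alternating_squares m))"
proof -
  have "(\<Sum>k\<le>p - 1. (- 1) ^ k * (P - 1 gchoose k) * leg (of_nat m) k)
      = (\<Sum>k\<le>m. (- 1) ^ k * leg (of_nat m) k * (P - 1 gchoose k))"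
    using m_less by (intro sum.mono_neutral_cong_right) (auto simp: leg_eq_0 mult_ac)
  also have "\<dots> = (- 1) ^ m * (\<Sum>k\<le>m. leg (of_nat m) k * (P - 1 + of_nat k gchoose k))"
    by (rule reflection)
  also have "(\<Sum>k\<le>m. leg (of_nat m) k * (P - 1 + of_nat k gchoose k))
      = 1 + (\<Sum>k=1..m. leg (of_nat m) k * (P - 1 + of_nat k gchoose k))"
    unfolding atMost_atLeast0 by (subst sum.atLeast_Suc_atMost) auto
  also have "(- 1) ^ m * \<dots> \<approx>\<^bsub>3\<^esub> (- 1) ^ m * (1 + (\<Sum>k=1..m. leg (of_nat m) k * (P * (1 / of_nat k + P * (harmonic (k - 1) / of_nat k)))))"
    using m_less by (intro qcong_mult_left qcong_add qcong_refl qcong_sum gbinomial_shift_expand Zp_leg Zp_intros) auto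
  also have "(\<Sum>k=1..m. leg (of_nat m) k * (P * (1 / of_nat k + P * (harmonic (k - 1) / of_nat k))))
      = P * (\<Sum>k=1..m. leg (of_nat m) k / of_nat k) + P\<^sup>2 * (\<Sum>k=1..m. leg (of_nat m) k * harmonic (k - 1) / of_nat k)"
    unfolding sum_distrib_left sum.distrib[symmetric] by (intro sum.cong refl) (simp add: algebra_simps power2_eq_square)
  finally show ?thesis
    unfolding sum_leg_over_index sum_leg_harmonic_over_index alternating_squares_def[symmetric]
    by (simp add: algebra_simps)
qed

section \<open>The two congruences\<close>

lemma of_nat_p_minus_1: "of_nat (p - 1) = P - 1"
  using p_ge_5 by (simp add: of_nat_diff)

lemma G_congruence:
  "of_nat (G (p - 1)) \<approx>\<^bsub>3\<^esub> (- 1) ^ ((p - 1) div 2) * 256 ^ (p - 1) + 3 * of_nat p ^ 2 * euler_number (p - 3)"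
proof -
  define s :: rat where "s = (- 1) ^ m"
  define H A E where "H = harmonic m" and "A = alternating_squares m" and "E = euler_number (p - 3)"
  have Z: "s \<in> Zp" "H \<in> Zp" "A \<in> Zp" "E \<in> Zp"
    unfolding s_def H_def A_def E_def using m_less
    by (auto intro!: Zp_intros Zp_harmonic Zp_alternating_squares Zp_euler_number)
  have ss: "s * s = 1" unfolding s_def using sign_sign_mult[of m 1] by simp
  define W S M where "W = (\<Sum>k\<le>p - 1. (- 1) ^ k * (P - 1 gchoose k) * leg (- 1 / 2) k)"
    and "S = (\<Sum>k\<le>p - 1. leg (- 1 / 2) k)"
    and "M = (\<Sum>k\<le>p - 1. (- 1) ^ k * (P - 1 gchoose k) * leg (of_nat m) k)"
  have S: "S \<approx>\<^bsub>3\<^esub> s * (1 - P\<^sup>2 * A / 2)" unfolding S_def s_def A_def by (rule sum_leg_half_cong)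
  have M: "M \<approx>\<^bsub>3\<^esub> s * (1 - 2 * P * H + 2 * P\<^sup>2 * (H\<^sup>2 + A))"
    unfolding M_def s_def A_def H_def by (rule sum_leg_signed_binomial)
  \<comment> \<open>Each coefficient is a multiple of \<open>p\<close>, so it suffices to know \<open>leg (-1/2) k\<close> modulo \<open>p^2\<close>.\<close>
  have "W - S = (\<Sum>k\<le>p - 1. ((- 1) ^ k * (P - 1 gchoose k) - 1) * leg (- 1 / 2) k)"
    unfolding W_def S_def by (simp add: sum_subtractf left_diff_distrib)
  also have "\<dots> \<approx>\<^bsub>3\<^esub> (\<Sum>k\<le>p - 1. ((- 1) ^ k * (P - 1 gchoose k) - 1) * leg (of_nat m) k)"
  proof (intro qcong_sum)
    fix k assume "k \<in> {..p - 1}"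
    then have k: "k < p" using p_ge_5 by auto
    have "(- 1) ^ k * (P - 1 gchoose k) \<approx>\<^bsub>1\<^esub> 1 - P * harmonic k"
      using signed_binomial_expand[OF k] by (rule qcong_mono) simp
    also have "1 - P * harmonic k \<approx>\<^bsub>1\<^esub> 1"
      by (intro qcongI[of _ _ _ "- harmonic k"] Zp_intros Zp_harmonic k) simp
    finally obtain c where c: "c \<in> Zp" "(- 1) ^ k * (P - 1 gchoose k) = 1 + P ^ 1 * c" by (rule qcongE)
    have "P * (c * leg (- 1 / 2) k) \<approx>\<^bsub>3\<^esub> P * (c * leg (of_nat m) k)"
      by (intro qcong_scale_p qcong_mult_left leg_half_cong c k)
    then show "((- 1) ^ k * (P - 1 gchoose k) - 1) * leg (- 1 / 2) k
        \<approx>\<^bsub>3\<^esub> ((- 1) ^ k * (P - 1 gchoose k) - 1) * leg (of_nat m) k"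
      unfolding c(2) by (simp add: mult.assoc)
  qed
  also have "\<dots> = M - s"
    unfolding M_def s_def sum_leg_nat[OF m_less(2), symmetric] by (simp add: sum_subtractf left_diff_distrib)
  finally have "W - S + S \<approx>\<^bsub>3\<^esub> (M - s) + S" by (rule qcong_add[OF _ qcong_refl])
  also have "\<dots> \<approx>\<^bsub>3\<^esub> (s * (1 - 2 * P * H + 2 * P\<^sup>2 * (H\<^sup>2 + A)) - s) + s * (1 - P\<^sup>2 * A / 2)"
    by (intro qcong_add qcong_diff M S qcong_refl)
  also have "\<dots> = s * (1 - 2 * P * H + 2 * P\<^sup>2 * H\<^sup>2) + P\<^sup>2 * (3 / 2 * s * A)"
    by (simp add: field_simps)
  also have "\<dots> \<approx>\<^bsub>3\<^esub> s * (1 - 2 * P * H + 2 * P\<^sup>2 * H\<^sup>2) + P\<^sup>2 * (3 / 2 * s * (2 * s * E))"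
  proof (intro qcong_add qcong_refl)
    have "P\<^sup>2 * (3 / 2 * s * A) \<approx>\<^bsub>3\<^esub> P\<^sup>2 * (3 / 2 * s * (2 * s * E))"
      using alternating_squares_euler unfolding A_def s_def E_def
      by (intro qcong_scale_p qcong_mult_left Zp_intros Zp_half)
    then show "P\<^sup>2 * (3 / 2 * s * A) \<approx>\<^bsub>3\<^esub> P\<^sup>2 * (3 / 2 * s * (2 * s * E))" .
  qed
  also have "3 / 2 * s * (2 * s * E) = 3 * E * (s * s)" by simp
  also have "\<dots> = 3 * E" by (simp add: ss)
  finally have "W \<approx>\<^bsub>3\<^esub> s * (1 - 2 * P * H + 2 * P\<^sup>2 * H\<^sup>2) + P\<^sup>2 * (3 * E)" by simp
  also have "\<dots> \<approx>\<^bsub>3\<^esub> s * 16 ^ (p - 1) + P\<^sup>2 * (3 * E)"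
    unfolding H_def by (intro qcong_add qcong_refl qcong_mult_left Z qcong_sym[OF sixteen_power_harmonic])
  finally have W: "W \<approx>\<^bsub>3\<^esub> s * 16 ^ (p - 1) + P\<^sup>2 * (3 * E)" .
  have GW: "of_nat (G (p - 1)) = 16 ^ (p - 1) * W"
    using G_eq_sum_leg[of "p - 1"] unfolding W_def of_nat_p_minus_1 by (simp add: field_simps)
  have "16 ^ (p - 1) * W \<approx>\<^bsub>3\<^esub> 16 ^ (p - 1) * (s * 16 ^ (p - 1) + P\<^sup>2 * (3 * E))"
    by (intro qcong_mult_left W Zp_intros)
  also have "\<dots> = s * 256 ^ (p - 1) + P\<^sup>2 * (16 ^ (p - 1) * (3 * E))"
    by (simp add: algebra_simps flip: power_mult_distrib)
  also have "\<dots> \<approx>\<^bsub>3\<^esub> s * 256 ^ (p - 1) + P\<^sup>2 * (1 * (3 * E))"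
  proof (intro qcong_add qcong_refl)
    have "(of_nat 2 ^ (p - 1)) ^ 4 \<approx>\<^bsub>1\<^esub> 1 ^ 4"
      using p_ge_5 by (intro qcong_power fermat_Zp Zp_1) auto
    also have "(of_nat 2 ^ (p - 1)) ^ 4 = (2 ^ 4 :: rat) ^ (p - 1)"
      unfolding power_mult[symmetric] by (simp add: mult.commute)
    finally have "16 ^ (p - 1) \<approx>\<^bsub>1\<^esub> 1" by simp
    then have "P\<^sup>2 * (16 ^ (p - 1) * (3 * E)) \<approx>\<^bsub>3\<^esub> P\<^sup>2 * (1 * (3 * E))"
      by (intro qcong_scale_p qcong_mult qcong_refl Zp_intros Z)
    then show "P\<^sup>2 * (16 ^ (p - 1) * (3 * E)) \<approx>\<^bsub>3\<^esub> P\<^sup>2 * (1 * (3 * E))" by simp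
  qed
  finally show ?thesis
    unfolding GW by (simp add: s_def E_def p_eq mult_ac)
qed

lemma sum_G_congruence:
  "(\<Sum>k=0..p - 1. of_nat (G k) / 16 ^ k) \<approx>\<^bsub>3\<^esub> of_nat p ^ 2 * (4 * (- 1) ^ ((p - 1) div 2) - 3)"
proof -
  define t where "t = leg (- 1 / 2)"
  define q where "q = p - 1"
  have q: "q < p" "p = Suc q" "P = of_nat q + 1" using p_ge_5 by (auto simp: q_def)
  have Zt: "t k \<in> Zp" if "k < p" for k unfolding t_def using that by (intro Zp_leg Zp_half Zp_intros)
  have "(\<Sum>n=0..q. of_nat (G n) / 16 ^ n) = (\<Sum>n=0..q. \<Sum>k\<le>q. (- 1) ^ k * (of_nat n gchoose k) * t k)"
    unfolding G_eq_sum_leg t_def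
    by (intro sum.cong refl sum.mono_neutral_left) (auto simp flip: binomial_gbinomial)
  also have "\<dots> = (\<Sum>k\<le>q. (- 1) ^ k * t k * (\<Sum>n=0..q. of_nat n gchoose k))"
    unfolding sum_distrib_left by (subst sum.swap) (simp add: mult_ac)
  also have "\<dots> = (\<Sum>k\<le>q. (- 1) ^ k * t k * (P gchoose Suc k))"
    unfolding gbinomial_sum_up_index q(3) by simp
  also have "\<dots> = (\<Sum>k<q. (- 1) ^ k * t k * (P gchoose Suc k)) + (- 1) ^ q * t q * (P gchoose Suc q)"
    by (simp add: lessThan_Suc_atMost[symmetric])
  also have "(- 1) ^ q * t q * (P gchoose Suc q) = t q"
  proof -
    have "(P gchoose Suc q) = 1" unfolding q(2) by (simp flip: binomial_gbinomial del: of_nat_Suc)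
    then show ?thesis using m_less(3) by (simp add: q_def)
  qed
  also have "(\<Sum>k<q. (- 1) ^ k * t k * (P gchoose Suc k)) = (\<Sum>k<q. P * ((t k * (1 / of_nat (Suc k))) * ((- 1) ^ k * (P - 1 gchoose k))))"
    by (intro sum.cong refl) (simp add: gbinomial_absorption' mult_ac)
  also have "\<dots> + t q \<approx>\<^bsub>3\<^esub> (\<Sum>k<q. P * ((t k * (1 / of_nat (Suc k))) * (1 - P * harmonic k))) + t q"
    using q(1) by (intro qcong_add qcong_refl qcong_sum qcong_scale_p qcong_mult_left signed_binomial_expand Zp_mult Zt Zp_divide_nat Zp_1) auto
  also have "(\<Sum>k<q. P * ((t k * (1 / of_nat (Suc k))) * (1 - P * harmonic k)))
     = P * (\<Sum>k<q. t k / of_nat (Suc k)) - P\<^sup>2 * (\<Sum>k<q. harmonic k * t k / of_nat (Suc k))"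
    unfolding sum_distrib_left sum_subtractf[symmetric]
    by (intro sum.cong refl) (simp add: right_diff_distrib diff_divide_distrib power2_eq_square mult_ac)
  also have "\<dots> + t q = P * (4 * of_nat q * t q)
      - P\<^sup>2 * (4 * of_nat q * harmonic q * t q - 4 * ((\<Sum>k\<le>q. t k) - 1)) + t q"
    unfolding t_def sum_leg_half_over_Suc sum_leg_half_harmonic_over_Suc ..
  also have "\<dots> \<approx>\<^bsub>3\<^esub> P * 0 - P\<^sup>2 * (0 - 4 * ((- 1) ^ m - 1)) + P\<^sup>2"
  proof -
    \<comment> \<open>The argument \<open>-1/2\<close> is \<open>j - 1 + p y\<close> with \<open>j = m + 1\<close> and \<open>y = -1/2\<close>, so \<open>t q\<close> is the square of \<open>-p / (p + 1)\<close> up to \<open>p^3\<close>.\<close>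
    define y :: rat where "y = - 1 / 2"
    have y: "y \<in> Zp" unfolding y_def by (intro Zp_half Zp_intros)
    have "of_nat (Suc m) - 1 + P * y = - 1 / 2" unfolding y_def P_eq by (simp add: field_simps)
    then have "(- 1 / 2 gchoose q) \<approx>\<^bsub>2\<^esub> P * y / of_nat (Suc m)"
      using gbinomial_p_minus_1[OF y, of "Suc m"] p_eq p_ge_5 by (simp add: q_def)
    also have "\<dots> = - P + P ^ 2 * (1 / of_nat (Suc m)) * (1 / 2)"
      unfolding y_def P_eq using of_nat_neq_0[of m, where 'a=rat]
      by (simp add: divide_simps del: of_nat_Suc) (simp add: algebra_simps power2_eq_square)
    also have "\<dots> \<approx>\<^bsub>2\<^esub> - P"
      by (rule qcongI[of _ _ _ "(1 / of_nat (Suc m)) * (1 / 2)"])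
         (simp, use p_eq p_ge_5 in \<open>intro Zp_intros Zp_divide_nat Zp_half, auto\<close>)
    finally obtain c where c: "c \<in> Zp" "(- 1 / 2 gchoose q) = - P + P\<^sup>2 * c" by (rule qcongE)
    have tq: "t q \<approx>\<^bsub>3\<^esub> P\<^sup>2"
      unfolding t_def leg_half c(2)
      by (rule qcongI[of _ _ _ "- 2 * c + P * c ^ 2"]) (simp add: algebra_simps eval_nat_numeral, intro Zp_intros c)
    then obtain d where d: "d \<in> Zp" "t q = P\<^sup>2 + P ^ 3 * d" by (rule qcongE)
    have t1: "P * (4 * of_nat q * t q) \<approx>\<^bsub>3\<^esub> P * 0"
      by (rule qcongI[of _ _ _ "4 * of_nat q * (1 + P * d)"])
         (simp add: d(2) algebra_simps eval_nat_numeral, intro Zp_intros d)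
    have t2: "4 * of_nat q * harmonic q * t q \<approx>\<^bsub>1\<^esub> 0"
      by (rule qcongI[of _ _ _ "4 * of_nat q * harmonic q * (P + P\<^sup>2 * d)"])
         (simp add: d(2) algebra_simps eval_nat_numeral, intro Zp_intros d Zp_harmonic q)
    have "(\<Sum>k\<le>q. t k) \<approx>\<^bsub>1\<^esub> (\<Sum>k\<le>q. leg (of_nat m) k)"
      unfolding t_def using q by (intro qcong_sum qcong_mono[OF leg_half_cong]) auto
    also have "\<dots> = (- 1) ^ m" using m_less by (intro sum_leg_nat) (simp add: q_def)
    finally have "P\<^sup>2 * (4 * of_nat q * harmonic q * t q - 4 * ((\<Sum>k\<le>q. t k) - 1))
        \<approx>\<^bsub>3\<^esub> P\<^sup>2 * (0 - 4 * ((- 1) ^ m - 1))"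
      by (intro qcong_scale_p qcong_diff t2 qcong_mult_left qcong_refl Zp_numeral)
    then show ?thesis using t1 tq by (intro qcong_add qcong_diff) simp_all
  qed
  also have "\<dots> = P ^ 2 * (4 * (- 1) ^ m - 3)"
    by (simp add: algebra_simps)
  finally show ?thesis
    by (simp add: q_def p_eq)
qed

end

theorem theorem1p1:
  fixes p :: nat
  assumes "prime p" and "p \<ge> 5"
  shows "rat_cong_prime_power p 3
           (of_nat (G (p - 1)))
           ((- 1) ^ ((p - 1) div 2) * 256 ^ (p - 1) + 3 * of_nat p ^ 2 * euler_number (p - 3))
       \<and> rat_cong_prime_power p 3
           (\<Sum>k=0..p - 1. of_nat (G k) / 16 ^ k)
           (of_nat p ^ 2 * (4 * (- 1) ^ ((p - 1) div 2) - 3))"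
proof -
  have "odd p" using assms by (intro prime_odd_nat) auto
  then have "p = 2 * ((p - 1) div 2) + 1" using assms(2) by (auto elim!: oddE)
  then interpret prime_ge_5 p "(p - 1) div 2"
    using assms by unfold_locales
  show ?thesis unfolding rat_cong_iff using G_congruence sum_G_congruence by blast
qed

end
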